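(* Let $\mathcal{R}$ be the Ramond algebra, $\lambda\in\mathbb{C}^*$ and $\alpha\in\mathbb{C}$. Let $$\Xi:=x^2\big(\Omega_{\mathcal{R}}(\lambda,0)_{\bar 0}\big)\oplus\Omega_{\mathcal{R}}(\lambda,0)_{\bar 1}.$$ Then the following statements hold. (1) $\Omega_{\mathcal{R}}(\lambda,\alpha)$ is simple if and only if $\alpha\neq 0$. (2) $\Omega_{\mathcal{R}}(\lambda,0)$ has a unique nonzero proper submodule, namely $\Xi$, and $\Omega_{\mathcal{R}}(\lambda,0)/\Xi$ is a $1$-dimensional trivial $\mathcal{R}$-module. (3) $\Xi\cong\Pi(\Omega_{\mathcal{R}}(\lambda,\frac12))$, so that $\Xi$ is an irreducible $\mathcal{R}$-module.
   Context: All spaces are over $\mathbb{C}$; $\mathbb{C}^*$ is the set of nonzero complex numbers. The Ramond algebra $\mathcal{R}$ is the Lie superalgebra whose even part has basis $\{L_n\mid n\in\mathbb{Z}\}$ and whose odd part has basis $\{G_r\mid r\in\mathbb{Z}\}$, with brackets $[L_m,L_n]=(m-n)L_{m+n}$, $[L_m,G_r]=(\frac m2-r)G_{m+r}$, $[G_r,G_s]=2L_{r+s}$. A module over a Lie superalgebra $A$ always means a supermodule $M=M_{\bar 0}\oplus M_{\bar 1}$ with $A_{\bar i}\cdot M_{\bar j}\subseteq M_{\bar i+\bar j}$; submodules are $\mathbb{Z}_2$-graded, and $\cong$ denotes (parity-preserving) isomorphism of supermodules. For a module $M$, $\Pi(M)$ is the module with the same underlying space and action and with parity exchanged: $(\Pi(M))_{\bar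 0}=M_{\bar 1}$, $(\Pi(M))_{\bar 1}=M_{\bar 0}$. For $\lambda\in\mathbb{C}^*$, $\alpha\in\mathbb{C}$, $\Omega_{\mathcal{R}}(\lambda,\alpha)$ is the $\mathcal{R}$-module with underlying space $\mathbb{C}[x^2]\oplus x\mathbb{C}[x^2]$ (part $\bar 0$ is $\mathbb{C}[x^2]$, part $\bar 1$ is $x\mathbb{C}[x^2]$) and action, for $m\in\mathbb{Z}$ and $f(x^2)\in\mathbb{C}[x^2]$: $L_mf(x^2)=\lambda^m(x^2+m\alpha)f(x^2+m)$, $L_m\,xf(x^2)=\lambda^mx(x^2+m\alpha+\frac m2)f(x^2+m)$, $G_mf(x^2)=\lambda^mxf(x^2+m)$, $G_m\,xf(x^2)=\lambda^m(x^2+2m\alpha)f(x^2+m)$. *)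

theory Defs
  imports
    "HOL-Library.Z2"
    "HOL-Library.Poly_Mapping"
    "HOL-Algebra.QuotRing"
    "HOL-Computational_Algebra.Polynomial"
    "Jordan_Normal_Form.VS_Connect"
begin

section \<open>Superspaces, Lie superalgebras and supermodules over the complex numbers\<close>

text \<open>
  Parities are elements of the two-element field \<^typ>\<open>bit\<close>. The records extend the
  \<^typ>\<open>('a, 'b) module\<close> record, which in turn extends rings; the fields \<^const>\<open>mult\<close> and
  \<^const>\<open>one\<close> carry no meaning here and are never referred to.
\<close>

abbreviation complex_field :: "complex ring"
  where "complex_field \<equiv> class_ring"

record 'v superspace = "(complex, 'v) module" +
  part :: "bit \<Rightarrow> 'v set"

locale superspace = vectorspace complex_field V for V :: "('v, 'b) superspace_scheme" (structure) +
  assumes part_subspace: "VectorSpace.subspace complex_field (part V i) V"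
    and part_sum: "part V 0 <+> part V 1 = carrier V"
    and part_disjoint: "part V 0 \<inter> part V 1 = {\<zero>}"

definition bilinear_on ::
  "(complex, 'u, 'x) module_scheme \<Rightarrow> (complex, 'v, 'y) module_scheme \<Rightarrow>
   (complex, 'w, 'z) module_scheme \<Rightarrow> ('u \<Rightarrow> 'v \<Rightarrow> 'w) \<Rightarrow> bool"
  where "bilinear_on U V W b \<longleftrightarrow>
    (\<forall>u\<in>carrier U. b u \<in> LinearCombinations.module_hom complex_field V W) \<and>
    (\<forall>v\<in>carrier V. (\<lambda>u. b u v) \<in> LinearCombinations.module_hom complex_field U W)"

text \<open>The sign $(-1)^{ij}$.\<close>
definition koszul :: "bit \<Rightarrow> bit \<Rightarrow> complex"
  where "koszul i j = (if i = 1 \<and> j = 1 then - 1 else 1)"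

record 'g lie_superalgebra = "'g superspace" +
  bracket :: "'g \<Rightarrow> 'g \<Rightarrow> 'g"

locale lie_superalgebra = superspace A for A :: "('g, 'a) lie_superalgebra_scheme" (structure) +
  assumes bracket_bilinear: "bilinear_on A A A (bracket A)"
    and bracket_part: "x \<in> part A i \<Longrightarrow> y \<in> part A j \<Longrightarrow> bracket A x y \<in> part A (i + j)"
    and bracket_skew: "x \<in> part A i \<Longrightarrow> y \<in> part A j \<Longrightarrow>
      bracket A x y = (- koszul i j) \<odot> bracket A y x"
    and bracket_jacobi: "x \<in> part A i \<Longrightarrow> y \<in> part A j \<Longrightarrow> z \<in> part A k \<Longrightarrow>
      bracket A x (bracket A y z) =
        bracket A (bracket A x y) z \<oplus> koszul i j \<odot> bracket A y (bracket A x z)"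

record ('g, 'v) supermodule = "'v superspace" +
  act :: "'g \<Rightarrow> 'v \<Rightarrow> 'v"

locale supermodule = A: lie_superalgebra A + superspace M
  for A :: "('g, 'a) lie_superalgebra_scheme" and M :: "('g, 'v, 'b) supermodule_scheme" (structure) +
  assumes act_bilinear: "bilinear_on A M M (act M)"
    and act_part: "x \<in> part A i \<Longrightarrow> v \<in> part M j \<Longrightarrow> act M x v \<in> part M (i + j)"
    and act_bracket: "x \<in> part A i \<Longrightarrow> y \<in> part A j \<Longrightarrow> v \<in> carrier M \<Longrightarrow>
      act M (bracket A x y) v =
        act M x (act M y v) \<ominus> koszul i j \<odot> act M y (act M x v)"

definition sub_supermodule ::
  "('g, 'a) lie_superalgebra_scheme \<Rightarrow> 'v set \<Rightarrow> ('g, 'v, 'b) supermodule_scheme \<Rightarrow> bool"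
  where "sub_supermodule A N M \<longleftrightarrow>
    supermodule A M \<and> VectorSpace.subspace complex_field N M \<and>
    N = (N \<inter> part M 0) <+>\<^bsub>M\<^esub> (N \<inter> part M 1) \<and>
    (\<forall>x\<in>carrier A. \<forall>v\<in>N. act M x v \<in> N)"

definition restrict_supermodule ::
  "('g, 'v, 'b) supermodule_scheme \<Rightarrow> 'v set \<Rightarrow> ('g, 'v, 'b) supermodule_scheme"
  where "restrict_supermodule M N = M\<lparr>carrier := N, part := (\<lambda>i. N \<inter> part M i)\<rparr>"

text \<open>
  Scalars and the algebra act on cosets as in \<^const>\<open>rcoset_mult\<close>: for a submodule \<open>N\<close>
  the coset of \<open>v\<close> goes to the coset of the image of \<open>v\<close>.
\<close>
definition quotient_supermodule ::
  "('g, 'v, 'b) supermodule_scheme \<Rightarrow> 'v set \<Rightarrow> ('g, 'v set) supermodule"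
  where "quotient_supermodule M N =
    \<lparr>carrier = a_rcosets\<^bsub>M\<^esub> N, mult = (\<lambda>X Y. N), one = N, zero = N, add = set_add M,
     smult = (\<lambda>c X. \<Union>v\<in>X. N +>\<^bsub>M\<^esub> (c \<odot>\<^bsub>M\<^esub> v)),
     part = (\<lambda>i. {N +>\<^bsub>M\<^esub> v | v. v \<in> part M i}),
     act = (\<lambda>x X. \<Union>v\<in>X. N +>\<^bsub>M\<^esub> act M x v)\<rparr>"

definition parity_change :: "('g, 'v, 'b) supermodule_scheme \<Rightarrow> ('g, 'v, 'b) supermodule_scheme"
  where "parity_change M = M\<lparr>part := (\<lambda>i. part M (i + 1))\<rparr>"

definition simple_supermodule ::
  "('g, 'a) lie_superalgebra_scheme \<Rightarrow> ('g, 'v, 'b) supermodule_scheme \<Rightarrow> bool"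
  where "simple_supermodule A M \<longleftrightarrow>
    supermodule A M \<and> carrier M \<noteq> {\<zero>\<^bsub>M\<^esub>} \<and>
    (\<forall>N. sub_supermodule A N M \<longrightarrow> N = {\<zero>\<^bsub>M\<^esub>} \<or> N = carrier M)"

definition trivial_supermodule ::
  "('g, 'a) lie_superalgebra_scheme \<Rightarrow> ('g, 'v, 'b) supermodule_scheme \<Rightarrow> bool"
  where "trivial_supermodule A M \<longleftrightarrow>
    supermodule A M \<and> (\<forall>x\<in>carrier A. \<forall>v\<in>carrier M. act M x v = \<zero>\<^bsub>M\<^esub>)"

definition supermodule_isomorphic ::
  "('g, 'a) lie_superalgebra_scheme \<Rightarrow> ('g, 'v, 'b) supermodule_scheme \<Rightarrow>
   ('g, 'w, 'c) supermodule_scheme \<Rightarrow> bool"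
  where "supermodule_isomorphic A M N \<longleftrightarrow> supermodule A M \<and> supermodule A N \<and>
    (\<exists>f. f \<in> LinearCombinations.module_hom complex_field M N \<and> bij_betw f (carrier M) (carrier N) \<and>
      (\<forall>i. f ` part M i \<subseteq> part N i) \<and>
      (\<forall>x\<in>carrier A. \<forall>v\<in>carrier M. f (act M x v) = act N x (f v)))"


section \<open>The Ramond algebra\<close>

datatype ramond_gen = gen_L int | gen_G int

fun gen_parity :: "ramond_gen \<Rightarrow> bit" where
  "gen_parity (gen_L m) = 0"
| "gen_parity (gen_G r) = 1"

fun gen_bracket :: "ramond_gen \<Rightarrow> ramond_gen \<Rightarrow> (ramond_gen \<Rightarrow>\<^sub>0 complex)" where
  "gen_bracket (gen_L m) (gen_L n) = Poly_Mapping.single (gen_L (m + n)) (of_int m - of_int n)"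
| "gen_bracket (gen_L m) (gen_G r) = Poly_Mapping.single (gen_G (m + r)) (of_int m / 2 - of_int r)"
| "gen_bracket (gen_G r) (gen_L m) = Poly_Mapping.single (gen_G (m + r)) (of_int r - of_int m / 2)"
| "gen_bracket (gen_G r) (gen_G s) = Poly_Mapping.single (gen_L (r + s)) 2"

definition pm_scale :: "complex \<Rightarrow> ('k \<Rightarrow>\<^sub>0 complex) \<Rightarrow> ('k \<Rightarrow>\<^sub>0 complex)"
  where "pm_scale c x = Poly_Mapping.map ((*) c) x"

text \<open>
  Finitely supported functions on the basis; the bracket is the bilinear extension of
  \<^const>\<open>gen_bracket\<close>, where $[G_r, L_m]$ is determined by super skew-symmetry.
\<close>
definition ramond :: "(ramond_gen \<Rightarrow>\<^sub>0 complex) lie_superalgebra"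
  where "ramond =
    \<lparr>carrier = UNIV, mult = (\<lambda>x y. 0), one = 0, zero = 0, add = (+),
     smult = pm_scale,
     part = (\<lambda>i. {x. \<forall>g\<in>Poly_Mapping.keys x. gen_parity g = i}),
     bracket = (\<lambda>x y. \<Sum>g\<in>Poly_Mapping.keys x. \<Sum>h\<in>Poly_Mapping.keys y.
       pm_scale (Poly_Mapping.lookup x g * Poly_Mapping.lookup y h) (gen_bracket g h))\<rparr>"

lemma bracket_ramond_single:
  "bracket ramond (Poly_Mapping.single g 1) (Poly_Mapping.single h 1) = gen_bracket g h"
  by (simp add: ramond_def pm_scale_def) (rule poly_mapping_eqI, simp add: Poly_Mapping.map.rep_eq when_def)


section \<open>The modules Omega\<close>

text \<open>The polynomial $f(x^2 + c)$ in $x$.\<close>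
definition at_sq :: "complex \<Rightarrow> complex poly \<Rightarrow> complex poly"
  where "at_sq c f = pcompose f [:c, 0, 1:]"

abbreviation var_x :: "complex poly"
  where "var_x \<equiv> [:0, 1:]"

text \<open>
  Every polynomial $h$ in $x$ is uniquely $f(x^2) + x g(x^2)$, where $f$ is \<open>half 0 h\<close>
  and $g$ is \<open>half 1 h\<close>.
\<close>
definition half :: "nat \<Rightarrow> complex poly \<Rightarrow> complex poly"
  where "half i h = (\<Sum>n\<le>degree h. monom (coeff h (2 * n + i)) n)"

fun omega_gen :: "complex \<Rightarrow> complex \<Rightarrow> ramond_gen \<Rightarrow> complex poly \<Rightarrow> complex poly" where
  "omega_gen lam \<alpha> (gen_L m) h = Polynomial.smult (lam powi m)
     ([:of_int m * \<alpha>, 0, 1:] * at_sq (of_int m) (half 0 h)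
      + var_x * [:of_int m * \<alpha> + of_int m / 2, 0, 1:] * at_sq (of_int m) (half 1 h))"
| "omega_gen lam \<alpha> (gen_G m) h = Polynomial.smult (lam powi m)
     (var_x * at_sq (of_int m) (half 0 h)
      + [:2 * of_int m * \<alpha>, 0, 1:] * at_sq (of_int m) (half 1 h))"

definition omega ::
  "complex \<Rightarrow> complex \<Rightarrow> (ramond_gen \<Rightarrow>\<^sub>0 complex, complex poly) supermodule"
  where "omega lam \<alpha> =
    \<lparr>carrier = UNIV, mult = (\<lambda>f g. 0), one = 0, zero = 0, add = (+),
     smult = Polynomial.smult,
     part = (\<lambda>i. if i = 0 then range (at_sq 0) else range (\<lambda>f. var_x * at_sq 0 f)),
     act = (\<lambda>x h. \<Sum>g\<in>Poly_Mapping.keys x.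
       Polynomial.smult (Poly_Mapping.lookup x g) (omega_gen lam \<alpha> g h))\<rparr>"

lemma coeff_at_sq_0: "coeff (at_sq 0 f) k = (if even k then coeff f (k div 2) else 0)"
proof (induction f arbitrary: k)
  case 0 then show ?case by (simp add: at_sq_def)
next
  case (pCons a f)
  have "at_sq 0 (pCons a f) = pCons a (pCons 0 (at_sq 0 f))"
    by (simp add: at_sq_def pcompose_pCons)
  then show ?case
    by (cases k) (auto simp: coeff_pCons pCons.IH split: nat.splits elim!: oddE evenE)
qed

lemma coeff_half: "coeff (half i h) n = coeff h (2 * n + i)"
proof -
  have "coeff (half i h) n = (\<Sum>k\<le>degree h. if k = n then coeff h (2 * k + i) else 0)"
    by (simp add: half_def coeff_sum)
  also have "\<dots> = (if n \<le> degree h then coeff h (2 * n + i) else 0)" by simp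
  also have "\<dots> = coeff h (2 * n + i)" by (auto simp: coeff_eq_0)
  finally show ?thesis .
qed

lemma coeff_var_x: "coeff (var_x * f) k = (if k = 0 then 0 else coeff f (k - 1))"
  by (cases k) (auto simp: coeff_pCons)

lemma half_decomp: "h = at_sq 0 (half 0 h) + var_x * at_sq 0 (half 1 h)"
  by (rule poly_eqI)
    (auto simp only: coeff_add coeff_at_sq_0 coeff_half coeff_var_x; auto elim!: oddE evenE)

lemma half_0_sum [simp]: "half 0 (at_sq 0 f + var_x * at_sq 0 g) = f"
  by (rule poly_eqI) (simp only: coeff_add coeff_half coeff_var_x coeff_at_sq_0, auto)

lemma half_1_sum [simp]: "half (Suc 0) (at_sq 0 f + var_x * at_sq 0 g) = g"
  by (rule poly_eqI) (simp only: coeff_add coeff_half coeff_var_x coeff_at_sq_0, auto)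

lemma half_sq [simp]: "half 0 (at_sq 0 f) = f" "half (Suc 0) (at_sq 0 f) = 0"
    "half 0 (var_x * at_sq 0 f) = 0" "half (Suc 0) (var_x * at_sq 0 f) = f"
  using half_0_sum[of f 0] half_1_sum[of f 0] half_0_sum[of 0 f] half_1_sum[of 0 f]
  by (simp_all add: at_sq_def del: half_0_sum half_1_sum)

lemma act_gen: "act (omega lam \<alpha>) (Poly_Mapping.single g 1) h = omega_gen lam \<alpha> g h"
  by (simp add: omega_def)

lemma act_L_even: "act (omega lam \<alpha>) (Poly_Mapping.single (gen_L m) 1) (at_sq 0 f) =
    Polynomial.smult (lam powi m) ((var_x ^ 2 + [:of_int m * \<alpha>:]) * at_sq (of_int m) f)"
  by (simp only: act_gen omega_gen.simps half_sq One_nat_def) (simp add: power2_eq_square at_sq_def)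

lemma act_L_odd: "act (omega lam \<alpha>) (Poly_Mapping.single (gen_L m) 1) (var_x * at_sq 0 f) =
    Polynomial.smult (lam powi m)
     (var_x * (var_x ^ 2 + [:of_int m * \<alpha> + of_int m / 2:]) * at_sq (of_int m) f)"
  by (simp only: act_gen omega_gen.simps half_sq One_nat_def) (simp add: power2_eq_square at_sq_def)

lemma act_G_even: "act (omega lam \<alpha>) (Poly_Mapping.single (gen_G m) 1) (at_sq 0 f) =
    Polynomial.smult (lam powi m) (var_x * at_sq (of_int m) f)"
  by (simp only: act_gen omega_gen.simps half_sq One_nat_def) (simp add: power2_eq_square at_sq_def)

lemma act_G_odd: "act (omega lam \<alpha>) (Poly_Mapping.single (gen_G m) 1) (var_x * at_sq 0 f) =
    Polynomial.smult (lam powi m) ((var_x ^ 2 + [:2 * of_int m * \<alpha>:]) * at_sq (of_int m) f)"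
  by (simp only: act_gen omega_gen.simps half_sq One_nat_def) (simp add: power2_eq_square at_sq_def)

definition Xi :: "complex \<Rightarrow> complex poly set"
  where "Xi lam =
    (\<lambda>f. var_x ^ 2 * f) ` part (omega lam 0) 0 <+>\<^bsub>omega lam 0\<^esub> part (omega lam 0) 1"

end

theory Submission
  imports Defs
begin

text \<open>
  Put $t = x^2$. A graded submodule $N$ of $\Omega(\lambda,\alpha)$ is a pair of subspaces
  $A$, $B$ of $\mathbb{C}[t]$, the even and the odd elements being $f(x^2)$ with $f \in A$ and
  $x g(x^2)$ with $g \in B$. Both are ideals because of $L_0$. Comparing $L_1$ with $G_0 G_1$
  gives $\alpha f(t+1) \in A$ for $f \in A$, and in the case $\alpha = 0$ gives
  $\frac12 g(t+1) \in B$ for $g \in B$. A nonzero ideal invariant under $t \mapsto t+1$ is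
  everything, since the difference operator lowers degrees. So for $\alpha \neq 0$ a nonzero $N$
  is the whole module, while for $\alpha = 0$ it contains $\Xi$, which has codimension one.
  The isomorphism from $\Xi$ to $\Pi(\Omega(\lambda,\frac12))$ is division by $x$.
\<close>

section \<open>Superspaces\<close>

text \<open>Up to a power of lam, \<open>L_1 - G_0 G_1\<close> is \<alpha> f(t+1) on even elements
  and (1/2 - \<alpha>) g(t+1) on odd ones. The first vanishes at \<alpha> = 0, the second at
  \<alpha> = 1/2, so neither component serves for all \<alpha>; this is why the two cases are argued
  on different components. The passage to the other component is made by \<open>G_0\<close>, which
  sends the pair (f, g) to (t g, f). From even to odd nothing is lost, but from odd to even only
  multiples of t are reached. For \<alpha> = 0 this loss is real and produces Xi. The parameter 1/2
  of the isomorphism comes from the summand m/2 that \<open>L_m\<close> carries on odd elements: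
  division by x turns odd elements into even ones, where the same summand has to be read as m
  \<alpha>.\<close>

lemma vectorspace_of_type:
  fixes V :: "(complex, 'v::ab_group_add, 'b) module_scheme"
  assumes "carrier V = UNIV" "add V = (+)" "zero V = 0" "vector_space (smult V)"
  shows "vectorspace complex_field V"
proof -
  interpret vector_space "smult V" by fact
  have "abelian_group V"
  proof (rule abelian_groupI)
    fix x assume "x \<in> carrier V"
    show "\<exists>y\<in>carrier V. y \<oplus>\<^bsub>V\<^esub> x = \<zero>\<^bsub>V\<^esub>"
      by (rule bexI[of _ "- x"]) (simp_all add: assms(1-3))
  qed (simp_all add: assms(1-3) algebra_simps)
  moreover have "module_axioms complex_field V"
    by unfold_locales (simp_all add: assms(1-3) scale_left_distrib scale_right_distrib)
  ultimately show ?thesis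
    by (simp add: vectorspace_def Module.module_def class_field class_cring.is_cring)
qed

text \<open>The additive inverse is chosen inside the carrier, so \<open>\<ominus>\<close> is not
  visibly the same operation after a change of the carrier. Addition and scalars are fields of the
  record, and through them subtraction can be compared between a module and its restriction or
  parity change.\<close>

lemma minus_eq_smult:
  assumes "vectorspace complex_field V" "v \<in> carrier V" "w \<in> carrier V"
  shows "v \<ominus>\<^bsub>V\<^esub> w = v \<oplus>\<^bsub>V\<^esub> (-1) \<odot>\<^bsub>V\<^esub> w"
proof -
  interpret vectorspace complex_field V by fact
  have "(-1) \<odot>\<^bsub>V\<^esub> w \<oplus>\<^bsub>V\<^esub> w = \<zero>\<^bsub>V\<^esub>"
    using smult_l_distr[of "-1" 1 w] smult_one[of w] lmult_0[of w] assms(3) by simp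
  then have "\<ominus>\<^bsub>V\<^esub> w = (-1) \<odot>\<^bsub>V\<^esub> w"
    using assms(3) by (intro minus_equality) simp_all
  then show ?thesis by (simp add: a_minus_def)
qed

lemma subspace_iff:
  assumes "vectorspace complex_field V"
  shows "VectorSpace.subspace complex_field N V \<longleftrightarrow>
    N \<subseteq> carrier V \<and> \<zero>\<^bsub>V\<^esub> \<in> N \<and> (\<forall>v\<in>N. \<forall>w\<in>N. v \<oplus>\<^bsub>V\<^esub> w \<in> N) \<and> (\<forall>c. \<forall>v\<in>N. c \<odot>\<^bsub>V\<^esub> v \<in> N)"
  using assms vectorspace.axioms(1)[OF assms]
  by (auto simp: VectorSpace.subspace_def submodule_def)

lemma module_hom_iff:
  "f \<in> LinearCombinations.module_hom complex_field V W \<longleftrightarrow>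
    f \<in> carrier V \<rightarrow> carrier W \<and>
    (\<forall>v\<in>carrier V. \<forall>w\<in>carrier V. f (v \<oplus>\<^bsub>V\<^esub> w) = f v \<oplus>\<^bsub>W\<^esub> f w) \<and>
    (\<forall>c. \<forall>v\<in>carrier V. f (c \<odot>\<^bsub>V\<^esub> v) = c \<odot>\<^bsub>W\<^esub> f v)"
  by (auto simp: LinearCombinations.module_hom_def)

lemma set_add_iff: "v \<in> X <+>\<^bsub>V\<^esub> Y \<longleftrightarrow> (\<exists>x\<in>X. \<exists>y\<in>Y. v = x \<oplus>\<^bsub>V\<^esub> y)"
  by (auto simp: set_add_def')

lemma set_add_cong: "add V = add W \<Longrightarrow> X <+>\<^bsub>V\<^esub> Y = X <+>\<^bsub>W\<^esub> Y"
  by (simp add: set_add_def')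

section \<open>Linear extension from a basis\<close>

lemma lookup_pm_scale [simp]: "Poly_Mapping.lookup (pm_scale c x) k = c * Poly_Mapping.lookup x k"
  by (simp add: pm_scale_def Poly_Mapping.map.rep_eq when_def)

lemma keys_pm_scale: "Poly_Mapping.keys (pm_scale c x) = (if c = 0 then {} else Poly_Mapping.keys x)"
  by (auto simp: in_keys_iff simp del: keys_eq_empty)

lemma pm_scale_single [simp]: "pm_scale c (Poly_Mapping.single k a) = Poly_Mapping.single k (c * a)"
  by (simp add: pm_scale_def Poly_Mapping.map_single)

interpretation pm: vector_space pm_scale
  by unfold_locales (auto intro!: poly_mapping_eqI simp: lookup_add algebra_simps)

interpretation poly: vector_space "Polynomial.smult :: complex \<Rightarrow> complex poly \<Rightarrow> complex poly"
  by unfold_locales (simp_all add: smult_add_right smult_add_left)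

text \<open>Both the bracket of \<open>ramond\<close> and the action on \<open>omega\<close> are of
  this form. The scalar multiplication is a parameter, so that one set of linearity laws serves the
  two target spaces.\<close>

definition lin_ext :: "(complex \<Rightarrow> 'v \<Rightarrow> 'v) \<Rightarrow> ('k \<Rightarrow> 'v::ab_group_add) \<Rightarrow> ('k \<Rightarrow>\<^sub>0 complex) \<Rightarrow> 'v"
  where "lin_ext s F x = (\<Sum>k\<in>Poly_Mapping.keys x. s (Poly_Mapping.lookup x k) (F k))"

lemma lin_ext_0 [simp]: "lin_ext s F 0 = 0"
  by (simp add: lin_ext_def)

context
  fixes s :: "complex \<Rightarrow> 'v::ab_group_add \<Rightarrow> 'v"
  assumes s: "vector_space s"
begin

interpretation vector_space s by fact

lemma lin_ext_add: "lin_ext s F (x + y) = lin_ext s F x + lin_ext s F y"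
  unfolding lin_ext_def by (rule setsum_keys_plus_distrib) (simp_all add: scale_left_distrib)

lemma lin_ext_scale: "lin_ext s F (pm_scale c x) = s c (lin_ext s F x)"
  by (auto simp: lin_ext_def keys_pm_scale scale_sum_right)

lemma lin_ext_single: "lin_ext s F (Poly_Mapping.single k c) = s c (F k)"
  by (simp add: lin_ext_def)

text \<open>Linearity in the values on the basis. The second argument of the bracket and of the
  action sits inside \<open>F\<close>, so this and the next law provide linearity there.\<close>

lemma lin_ext_fun_add: "lin_ext s (\<lambda>k. F k + G k) x = lin_ext s F x + lin_ext s G x"
  by (simp add: lin_ext_def scale_right_distrib sum.distrib)

lemma lin_ext_fun_scale: "lin_ext s (\<lambda>k. s c (F k)) x = s c (lin_ext s F x)"
  by (simp add: lin_ext_def scale_sum_right mult.commute)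

end

lemma poly_mapping_as_lin_ext: "x = lin_ext pm_scale (\<lambda>k. Poly_Mapping.single k 1) x"
  by (rule poly_mapping_eqI)
    (auto simp: lin_ext_def lookup_sum lookup_single when_def in_keys_iff)

text \<open>Reduces linear statements to basis elements. The bound \<open>K\<close> on the support
  is there for homogeneous elements, whose support consists of generators of one parity; arbitrary
  elements take \<open>K = UNIV\<close>.\<close>

lemma poly_mapping_linear_induct [consumes 1, case_names zero add scale single]:
  assumes "Poly_Mapping.keys x \<subseteq> K"
    and "P 0" and add: "\<And>y z. P y \<Longrightarrow> P z \<Longrightarrow> P (y + z)" and scale: "\<And>c y. P y \<Longrightarrow> P (pm_scale c y)"
    and single: "\<And>k. k \<in> K \<Longrightarrow> P (Poly_Mapping.single k 1)"
  shows "P x"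
proof -
  \<comment> \<open>The induction runs over finite index sets while the coefficients stay those of
    the fixed \<open>x\<close>; the full support then gives back \<open>x\<close>.\<close>
  have "P (\<Sum>k\<in>S. pm_scale (Poly_Mapping.lookup x k) (Poly_Mapping.single k 1))"
    if "finite S" "S \<subseteq> K" for S
    using that by (induction S) (auto intro: assms simp del: pm_scale_single)
  from this[of "Poly_Mapping.keys x"] show ?thesis
    using assms(1) poly_mapping_as_lin_ext[of x] by (simp add: lin_ext_def)
qed

section \<open>The Ramond algebra\<close>

lemma ramond_simps [simp]:
  "carrier ramond = UNIV" "add ramond = (+)" "zero ramond = 0" "smult ramond = pm_scale"
  by (simp_all add: ramond_def)

lemma part_ramond: "x \<in> part ramond i \<longleftrightarrow> (\<forall>k\<in>Poly_Mapping.keys x. gen_parity k = i)"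
  by (simp add: ramond_def)

lemma vectorspace_ramond: "vectorspace complex_field ramond"
  by (rule vectorspace_of_type) (simp_all add: pm.vector_space_axioms)

lemma bracket_ramond:
  "bracket ramond x y = lin_ext pm_scale (\<lambda>g. lin_ext pm_scale (gen_bracket g) y) x"
  by (simp add: ramond_def lin_ext_def pm.scale_sum_right)

lemmas pm_lin_ext =
  lin_ext_add[OF pm.vector_space_axioms] lin_ext_scale[OF pm.vector_space_axioms]
  lin_ext_single[OF pm.vector_space_axioms]
  lin_ext_fun_add[OF pm.vector_space_axioms] lin_ext_fun_scale[OF pm.vector_space_axioms]

lemma bracket_ramond_simps [simp]:
  "bracket ramond 0 y = 0" "bracket ramond x 0 = 0"
  "bracket ramond (x + x') y = bracket ramond x y + bracket ramond x' y"
  "bracket ramond x (y + y') = bracket ramond x y + bracket ramond x y'"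
  "bracket ramond (pm_scale c x) y = pm_scale c (bracket ramond x y)"
  "bracket ramond x (pm_scale c y) = pm_scale c (bracket ramond x y)"
  "bracket ramond (Poly_Mapping.single g a) (Poly_Mapping.single h b) = pm_scale (a * b) (gen_bracket g h)"
  by (simp_all add: bracket_ramond pm_lin_ext) (simp add: lin_ext_def)

lemma part_ramond_induct [consumes 1, case_names zero add scale single]:
  assumes "x \<in> part ramond i"
    and "P 0" and "\<And>y z. P y \<Longrightarrow> P z \<Longrightarrow> P (y + z)" and "\<And>c y. P y \<Longrightarrow> P (pm_scale c y)"
    and "\<And>g. gen_parity g = i \<Longrightarrow> P (Poly_Mapping.single g 1)"
  shows "P x"
  by (rule poly_mapping_linear_induct[of x "{g. gen_parity g = i}"])
    (use assms in \<open>auto simp: part_ramond\<close>)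

lemma subspace_part_ramond: "VectorSpace.subspace complex_field (part ramond i) ramond"
  unfolding subspace_iff[OF vectorspace_ramond]
  by (auto simp: part_ramond keys_pm_scale dest!: subsetD[OF keys_add])

lemma part_ramond_0: "0 \<in> part ramond i"
  by (simp add: part_ramond)

lemma part_ramond_add: "x \<in> part ramond i \<Longrightarrow> y \<in> part ramond i \<Longrightarrow> x + y \<in> part ramond i"
  by (auto simp: part_ramond dest!: subsetD[OF keys_add])

lemma part_ramond_scale: "x \<in> part ramond i \<Longrightarrow> pm_scale c x \<in> part ramond i"
  by (auto simp: part_ramond keys_pm_scale)

lemma part_ramond_single: "gen_parity g = i \<Longrightarrow> Poly_Mapping.single g c \<in> part ramond i"
  by (simp add: part_ramond)

lemma superspace_ramond: "superspace ramond"
proof (intro superspace.intro superspace_axioms.intro vectorspace_ramond subspace_part_ramond)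
  have "x \<in> part ramond 0 <+>\<^bsub>ramond\<^esub> part ramond 1" for x
  proof (rule poly_mapping_linear_induct[of x UNIV])
    fix k
    show "Poly_Mapping.single k 1 \<in> part ramond 0 <+>\<^bsub>ramond\<^esub> part ramond 1"
      unfolding set_add_iff ramond_simps
      by (cases k) (metis add_0 add_0_right gen_parity.simps part_ramond_0 part_ramond_single)+
  next
    fix y z assume "y \<in> part ramond 0 <+>\<^bsub>ramond\<^esub> part ramond 1" "z \<in> part ramond 0 <+>\<^bsub>ramond\<^esub> part ramond 1"
    then obtain a b c d where "y = a + b" "z = c + d"
      "a \<in> part ramond 0" "b \<in> part ramond 1" "c \<in> part ramond 0" "d \<in> part ramond 1"
      by (auto simp: set_add_iff)
    then show "y + z \<in> part ramond 0 <+>\<^bsub>ramond\<^esub> part ramond 1"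
      unfolding set_add_iff
      by (intro bexI[of _ "a + c"] bexI[of _ "b + d"]) (auto intro: part_ramond_add)
  next
    fix c y assume "y \<in> part ramond 0 <+>\<^bsub>ramond\<^esub> part ramond 1"
    then show "pm_scale c y \<in> part ramond 0 <+>\<^bsub>ramond\<^esub> part ramond 1"
      by (auto simp: set_add_iff pm.scale_right_distrib intro!: bexI part_ramond_scale)
  qed (auto simp: set_add_iff intro!: bexI[of _ 0] part_ramond_0)
  then show "part ramond 0 <+>\<^bsub>ramond\<^esub> part ramond 1 = carrier ramond"
    by auto
  have "x = 0" if "x \<in> part ramond 0" "x \<in> part ramond 1" for x
    using that by (auto simp: part_ramond simp flip: keys_eq_empty)
  then show "part ramond 0 \<inter> part ramond 1 = {\<zero>\<^bsub>ramond\<^esub>}"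
    by (auto intro: part_ramond_0)
qed

lemma gen_bracket_part: "gen_bracket g h \<in> part ramond (gen_parity g + gen_parity h)"
  by (cases g; cases h) (auto intro: part_ramond_single)

lemma gen_bracket_skew:
  "gen_bracket g h = pm_scale (- koszul (gen_parity g) (gen_parity h)) (gen_bracket h g)"
  by (cases g; cases h) (simp_all add: koszul_def algebra_simps)

text \<open>In each of the eight cases all terms are multiples of one generator, whose index is the
  sum of the three given ones. What remains is an identity between rational coefficients.\<close>

lemma gen_bracket_jacobi:
  "bracket ramond (Poly_Mapping.single g 1) (gen_bracket h k) =
    bracket ramond (gen_bracket g h) (Poly_Mapping.single k 1) +
    pm_scale (koszul (gen_parity g) (gen_parity h))
      (bracket ramond (Poly_Mapping.single h 1) (gen_bracket g k))"
  by (cases g; cases h; cases k; simp add: koszul_def ac_simps flip: single_add;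
      intro arg_cong2[where f = Poly_Mapping.single]; simp add: field_simps)

text \<open>Skew-symmetry, the Jacobi identity and the parity rule are linear in each argument once
  the parities are fixed, so nested inductions over homogeneous elements leave only the checks on
  generators.\<close>

lemma lie_superalgebra_ramond: "lie_superalgebra ramond"
proof (intro lie_superalgebra.intro lie_superalgebra_axioms.intro superspace_ramond)
  show "bilinear_on ramond ramond ramond (bracket ramond)"
    by (simp add: bilinear_on_def module_hom_iff)
next
  fix x y i j assume x: "x \<in> part ramond i" and y: "y \<in> part ramond j"
  show "bracket ramond x y \<in> part ramond (i + j)"
    using x
  proof (induction rule: part_ramond_induct)
    case (single g)
    show ?case using y
    proof (induction rule: part_ramond_induct)
      case (single h)
      then show ?case
        using gen_bracket_part[of g h] \<open>gen_parity g = i\<close> by (simp del: add_bit_eq_xor)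
    qed (auto intro: part_ramond_0 part_ramond_add part_ramond_scale)
  qed (auto intro: part_ramond_0 part_ramond_add part_ramond_scale)
  show "bracket ramond x y = (- koszul i j) \<odot>\<^bsub>ramond\<^esub> bracket ramond y x"
    using x
  proof (induction rule: part_ramond_induct)
    case (single g)
    show ?case using y
    proof (induction rule: part_ramond_induct)
      case (single h)
      then show ?case
        using gen_bracket_skew[of g h] \<open>gen_parity g = i\<close> by simp
    qed (simp_all add: pm.scale_right_distrib mult.commute)
  qed (simp_all add: pm.scale_right_distrib mult.commute)
next
  fix x y z i j k
  assume x: "x \<in> part ramond i" and y: "y \<in> part ramond j" and z: "z \<in> part ramond k"
  show "bracket ramond x (bracket ramond y z) = bracket ramond (bracket ramond x y) z \<oplus>\<^bsub>ramond\<^esub>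
    koszul i j \<odot>\<^bsub>ramond\<^esub> bracket ramond y (bracket ramond x z)"
    using x
  proof (induction rule: part_ramond_induct)
    case g: (single g)
    show ?case using y
    proof (induction rule: part_ramond_induct)
      case h: (single h)
      show ?case using z
      proof (induction rule: part_ramond_induct)
        case (single k)
        show ?case
          using gen_bracket_jacobi[of g h k] g h by simp
      qed (simp_all add: pm.scale_right_distrib mult.commute)
    qed (simp_all add: pm.scale_right_distrib mult.commute)
  qed (simp_all add: pm.scale_right_distrib mult.commute)
qed

section \<open>The modules Omega\<close>

lemma poly_eqI_eval: "(\<And>t. poly p t = poly q t) \<Longrightarrow> p = q" for p q :: "complex poly"
  by (metis ext poly_eq_poly_eq_iff)

definition shift :: "complex \<Rightarrow> complex poly \<Rightarrow> complex poly"
  where "shift c f = pcompose f [:c, 1:]"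

lemma poly_shift [simp]: "poly (shift c f) t = poly f (t + c)"
  by (simp add: shift_def poly_pcompose add.commute)

lemma poly_at_sq [simp]: "poly (at_sq c f) t = poly f (t\<^sup>2 + c)"
  by (simp add: at_sq_def poly_pcompose power2_eq_square add.commute)

text \<open>Together with \<open>at_sq_eq\<close> this brings every summand of
  \<open>omega_gen\<close> into the form \<open>at_sq 0\<close>, from which \<open>half\<close>
  reads off the components.\<close>

lemma sq_times_at_sq: "[:a, 0, 1:] * at_sq c f = at_sq 0 ([:a, 1:] * shift c f)"
  by (rule poly_eqI_eval) (simp add: power2_eq_square)

lemma at_sq_eq: "at_sq c f = at_sq 0 (shift c f)"
  by (rule poly_eqI_eval) simp

lemma half_add: "half i (h + h') = half i h + half i h'"
  by (rule poly_eqI) (simp add: coeff_half)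

lemma half_diff: "half i (h - h') = half i h - half i h'"
  by (rule poly_eqI) (simp add: coeff_half)

lemma half_smult: "half i (Polynomial.smult c h) = Polynomial.smult c (half i h)"
  by (rule poly_eqI) (simp add: coeff_half)

lemma half_zero [simp]: "half i 0 = 0"
  by (rule poly_eqI) (simp add: coeff_half)

lemmas half_linear = half_add half_diff half_smult

text \<open>Combined with \<open>poly_eqI_eval\<close>, this turns an identity in the module into
  two identities between complex numbers at an arbitrary point t, one for each half.\<close>

lemma half_eqI: "half 0 h = half 0 h' \<Longrightarrow> half (Suc 0) h = half (Suc 0) h' \<Longrightarrow> h = h'"
  using half_decomp[of h] half_decomp[of h'] by simp

lemma at_sq_zero [simp]: "at_sq c 0 = 0"
  by (simp add: at_sq_def)

text \<open>In terms of t = x^2, \<open>L_m\<close> keeps the two halves apart and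
  \<open>G_m\<close> exchanges them, each shifting the argument by m. These rules replace the
  defining equations of \<open>omega_gen\<close> from here on.\<close>

lemma half_omega_gen [simp]:
  "half 0 (omega_gen lam \<alpha> (gen_L m) h) =
    Polynomial.smult (lam powi m) ([:of_int m * \<alpha>, 1:] * shift (of_int m) (half 0 h))"
  "half (Suc 0) (omega_gen lam \<alpha> (gen_L m) h) =
    Polynomial.smult (lam powi m) ([:of_int m * \<alpha> + of_int m / 2, 1:] * shift (of_int m) (half (Suc 0) h))"
  "half 0 (omega_gen lam \<alpha> (gen_G m) h) =
    Polynomial.smult (lam powi m) ([:2 * of_int m * \<alpha>, 1:] * shift (of_int m) (half (Suc 0) h))"
  "half (Suc 0) (omega_gen lam \<alpha> (gen_G m) h) =
    Polynomial.smult (lam powi m) (shift (of_int m) (half 0 h))"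
proof -
  have L: "omega_gen lam \<alpha> (gen_L m) h = Polynomial.smult (lam powi m)
      (at_sq 0 ([:of_int m * \<alpha>, 1:] * shift (of_int m) (half 0 h)) +
       var_x * at_sq 0 ([:of_int m * \<alpha> + of_int m / 2, 1:] * shift (of_int m) (half 1 h)))"
    by (simp only: omega_gen.simps sq_times_at_sq mult.assoc)
  have G: "omega_gen lam \<alpha> (gen_G m) h = Polynomial.smult (lam powi m)
      (at_sq 0 ([:2 * of_int m * \<alpha>, 1:] * shift (of_int m) (half 1 h)) +
       var_x * at_sq 0 (shift (of_int m) (half 0 h)))"
    unfolding omega_gen.simps sq_times_at_sq by (subst at_sq_eq) (rule arg_cong[OF add.commute])
  show
    "half 0 (omega_gen lam \<alpha> (gen_L m) h) =
      Polynomial.smult (lam powi m) ([:of_int m * \<alpha>, 1:] * shift (of_int m) (half 0 h))"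
    "half (Suc 0) (omega_gen lam \<alpha> (gen_L m) h) =
      Polynomial.smult (lam powi m) ([:of_int m * \<alpha> + of_int m / 2, 1:] * shift (of_int m) (half (Suc 0) h))"
    unfolding L by (simp_all only: half_smult half_0_sum half_1_sum One_nat_def)
  show
    "half 0 (omega_gen lam \<alpha> (gen_G m) h) =
      Polynomial.smult (lam powi m) ([:2 * of_int m * \<alpha>, 1:] * shift (of_int m) (half (Suc 0) h))"
    "half (Suc 0) (omega_gen lam \<alpha> (gen_G m) h) =
      Polynomial.smult (lam powi m) (shift (of_int m) (half 0 h))"
    unfolding G by (simp_all only: half_smult half_0_sum half_1_sum One_nat_def)
qed

declare omega_gen.simps [simp del]

lemma omega_gen_add: "omega_gen lam \<alpha> g (h + h') = omega_gen lam \<alpha> g h + omega_gen lam \<alpha> g h'"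
  by (cases g; rule half_eqI; rule poly_eqI_eval; simp add: half_linear algebra_simps)

lemma omega_gen_smult: "omega_gen lam \<alpha> g (Polynomial.smult c h) = Polynomial.smult c (omega_gen lam \<alpha> g h)"
  by (cases g; rule half_eqI; rule poly_eqI_eval; simp add: half_linear algebra_simps)

section \<open>Omega as a supermodule\<close>

lemma omega_simps [simp]:
  "carrier (omega lam \<alpha>) = UNIV" "add (omega lam \<alpha>) = (+)" "zero (omega lam \<alpha>) = 0"
  "smult (omega lam \<alpha>) = Polynomial.smult"
  by (simp_all add: omega_def)

lemma part_omega_iff:
  "h \<in> part (omega lam \<alpha>) 0 \<longleftrightarrow> half (Suc 0) h = 0"
  "h \<in> part (omega lam \<alpha>) 1 \<longleftrightarrow> half 0 h = 0"
proof -
  have "h = at_sq 0 (half 0 h)" if "half (Suc 0) h = 0"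
    using half_decomp[of h] that by (simp only: One_nat_def at_sq_zero mult_zero_right add_0_right)
  then show "h \<in> part (omega lam \<alpha>) 0 \<longleftrightarrow> half (Suc 0) h = 0"
    using half_sq(2) by (auto simp: omega_def)
  have "h = var_x * at_sq 0 (half (Suc 0) h)" if "half 0 h = 0"
    using half_decomp[of h] that by (simp only: One_nat_def at_sq_zero add_0_left)
  then have "h \<in> range (\<lambda>f. var_x * at_sq 0 f) \<longleftrightarrow> half 0 h = 0"
    using half_sq(3) by blast
  then show "h \<in> part (omega lam \<alpha>) 1 \<longleftrightarrow> half 0 h = 0"
    by (simp add: omega_def)
qed

lemma vectorspace_omega: "vectorspace complex_field (omega lam \<alpha>)"
  by (rule vectorspace_of_type) (simp_all add: poly.vector_space_axioms)

lemma minus_omega [simp]: "v \<ominus>\<^bsub>omega lam \<alpha>\<^esub> w = v - w"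
  by (simp add: minus_eq_smult[OF vectorspace_omega])

lemma act_omega: "act (omega lam \<alpha>) x h = lin_ext Polynomial.smult (\<lambda>g. omega_gen lam \<alpha> g h) x"
  by (simp add: omega_def lin_ext_def)

lemmas poly_lin_ext =
  lin_ext_add[OF poly.vector_space_axioms] lin_ext_scale[OF poly.vector_space_axioms]
  lin_ext_single[OF poly.vector_space_axioms]
  lin_ext_fun_add[OF poly.vector_space_axioms] lin_ext_fun_scale[OF poly.vector_space_axioms]

lemma act_omega_simps [simp]:
  "act (omega lam \<alpha>) 0 h = 0"
  "act (omega lam \<alpha>) (x + y) h = act (omega lam \<alpha>) x h + act (omega lam \<alpha>) y h"
  "act (omega lam \<alpha>) (pm_scale c x) h = Polynomial.smult c (act (omega lam \<alpha>) x h)"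
  "act (omega lam \<alpha>) (Poly_Mapping.single g c) h = Polynomial.smult c (omega_gen lam \<alpha> g h)"
  "act (omega lam \<alpha>) x (h + h') = act (omega lam \<alpha>) x h + act (omega lam \<alpha>) x h'"
  "act (omega lam \<alpha>) x (Polynomial.smult c h) = Polynomial.smult c (act (omega lam \<alpha>) x h)"
  by (simp_all add: act_omega poly_lin_ext omega_gen_add omega_gen_smult)

lemma act_omega_zero [simp]: "act (omega lam \<alpha>) x 0 = 0"
  using act_omega_simps(6)[of lam \<alpha> x 0 0] by simp

lemma superspace_omega: "superspace (omega lam \<alpha>)"
proof (intro superspace.intro superspace_axioms.intro vectorspace_omega)
  fix i :: bit
  show "VectorSpace.subspace complex_field (part (omega lam \<alpha>) i) (omega lam \<alpha>)"
    unfolding subspace_iff[OF vectorspace_omega]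
    by (cases i) (auto simp: part_omega_iff half_linear)
next
  have "h \<in> part (omega lam \<alpha>) 0 <+>\<^bsub>omega lam \<alpha>\<^esub> part (omega lam \<alpha>) 1" for h
    unfolding set_add_iff part_omega_iff Bex_def omega_simps
    using half_decomp[of h] half_sq by (metis One_nat_def)
  then show "part (omega lam \<alpha>) 0 <+>\<^bsub>omega lam \<alpha>\<^esub> part (omega lam \<alpha>) 1 = carrier (omega lam \<alpha>)"
    by auto
  show "part (omega lam \<alpha>) 0 \<inter> part (omega lam \<alpha>) 1 = {\<zero>\<^bsub>omega lam \<alpha>\<^esub>}"
    by (auto simp: part_omega_iff intro: half_eqI)
qed

lemma part_omega_0: "0 \<in> part (omega lam \<alpha>) i"
  by (cases i) (auto simp: part_omega_iff)

lemma part_omega_add: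
  "h \<in> part (omega lam \<alpha>) i \<Longrightarrow> h' \<in> part (omega lam \<alpha>) i \<Longrightarrow> h + h' \<in> part (omega lam \<alpha>) i"
  by (cases i) (auto simp: part_omega_iff half_linear)

lemma part_omega_smult:
  "h \<in> part (omega lam \<alpha>) i \<Longrightarrow> Polynomial.smult c h \<in> part (omega lam \<alpha>) i"
  by (cases i) (auto simp: part_omega_iff half_linear)

lemma shift_poly_0 [simp]: "shift c 0 = 0"
  by (simp add: shift_def)

lemma omega_gen_part:
  "h \<in> part (omega lam \<alpha>) j \<Longrightarrow> omega_gen lam \<alpha> g h \<in> part (omega lam \<alpha>) (gen_parity g + j)"
  by (cases g; cases j) (auto simp: part_omega_iff)

text \<open>Either order of two generators of indices m and n evaluates a half of \<open>v\<close>
  at t + m + n and contributes lam^(m+n); splitting this power for integer exponents requires lam to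
  be nonzero. After cancellation only the linear factors are compared.\<close>

lemma omega_gen_bracket:
  assumes "lam \<noteq> 0"
  shows "act (omega lam \<alpha>) (gen_bracket g h) v = omega_gen lam \<alpha> g (omega_gen lam \<alpha> h v) -
    Polynomial.smult (koszul (gen_parity g) (gen_parity h)) (omega_gen lam \<alpha> h (omega_gen lam \<alpha> g v))"
  by (cases g; cases h; rule half_eqI; rule poly_eqI_eval;
      simp add: half_linear koszul_def power_int_add assms add.assoc add.left_commute;
      simp add: field_simps)

lemma supermodule_omega:
  assumes "lam \<noteq> 0"
  shows "supermodule ramond (omega lam \<alpha>)"
proof (intro supermodule.intro supermodule_axioms.intro lie_superalgebra_ramond superspace_omega)
  show "bilinear_on ramond (omega lam \<alpha>) (omega lam \<alpha>) (act (omega lam \<alpha>))"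
    by (simp add: bilinear_on_def module_hom_iff mult.commute)
next
  fix x v i j assume "x \<in> part ramond i" and v: "v \<in> part (omega lam \<alpha>) j"
  then show "act (omega lam \<alpha>) x v \<in> part (omega lam \<alpha>) (i + j)"
  proof (induction rule: part_ramond_induct)
    case (single g)
    then show ?case using omega_gen_part[OF v, of g] by (simp del: add_bit_eq_xor)
  qed (auto intro: part_omega_0 part_omega_add part_omega_smult)
next
  fix x y v i j assume x: "x \<in> part ramond i" and y: "y \<in> part ramond j"
  show "act (omega lam \<alpha>) (bracket ramond x y) v = act (omega lam \<alpha>) x (act (omega lam \<alpha>) y v)
    \<ominus>\<^bsub>omega lam \<alpha>\<^esub> koszul i j \<odot>\<^bsub>omega lam \<alpha>\<^esub> act (omega lam \<alpha>) y (act (omega lam \<alpha>) x v)"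
    using x
  proof (induction rule: part_ramond_induct)
    case g: (single g)
    show ?case using y
    proof (induction rule: part_ramond_induct)
      case (single h)
      then show ?case using g omega_gen_bracket[OF assms, of \<alpha> g h v] by simp
    qed (simp_all add: smult_add_right smult_diff_right mult.commute)
  qed (simp_all add: smult_add_right smult_diff_right mult.commute)
qed

section \<open>Submodules\<close>

definition join :: "complex poly \<Rightarrow> complex poly \<Rightarrow> complex poly"
  where "join f g = at_sq 0 f + var_x * at_sq 0 g"

lemma half_join [simp]: "half 0 (join f g) = f" "half (Suc 0) (join f g) = g"
  unfolding join_def by (rule half_0_sum half_1_sum)+

lemma join_half [simp]: "join (half 0 h) (half (Suc 0) h) = h"
  by (rule half_eqI) simp_all

lemma join_add: "join f g + join f' g' = join (f + f') (g + g')"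
  by (rule half_eqI) (simp_all add: half_linear)

lemma join_diff: "join f g - join f' g' = join (f - f') (g - g')"
  by (rule half_eqI) (simp_all add: half_linear)

lemma join_zero [simp]: "join 0 0 = 0"
  by (rule half_eqI) simp_all

lemma shift_by_0 [simp]: "shift 0 f = f"
  by (rule poly_eqI_eval) simp

lemma join_smult: "Polynomial.smult c (join f g) = join (Polynomial.smult c f) (Polynomial.smult c g)"
  by (rule half_eqI) (simp_all add: half_linear)

lemma coeff_0_half: "coeff (half 0 h) 0 = coeff h 0"
  by (simp add: coeff_half)

lemma coeff_0_join [simp]: "coeff (join f g) 0 = coeff f 0"
  using coeff_0_half[of "join f g"] by simp

lemma omega_gen_join:
  "omega_gen lam \<alpha> (gen_L m) (join f g) = Polynomial.smult (lam powi m)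
    (join ([:of_int m * \<alpha>, 1:] * shift (of_int m) f) ([:of_int m * \<alpha> + of_int m / 2, 1:] * shift (of_int m) g))"
  "omega_gen lam \<alpha> (gen_G m) (join f g) = Polynomial.smult (lam powi m)
    (join ([:2 * of_int m * \<alpha>, 1:] * shift (of_int m) g) (shift (of_int m) f))"
  by (rule half_eqI; simp add: half_linear)+

lemma sub_supermoduleD:
  assumes "sub_supermodule A N M"
  shows "supermodule A M" "VectorSpace.subspace complex_field N M"
    "N = (N \<inter> part M 0) <+>\<^bsub>M\<^esub> (N \<inter> part M 1)"
    "x \<in> carrier A \<Longrightarrow> v \<in> N \<Longrightarrow> act M x v \<in> N"
  using assms unfolding sub_supermodule_def by metis+

text \<open>Stability under generators extends to the algebra by linearity. For gradedness it is
  enough to project to the even component, because the odd component is the difference.\<close>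

lemma sub_supermodule_omega_iff:
  assumes "lam \<noteq> 0"
  shows "sub_supermodule ramond N (omega lam \<alpha>) \<longleftrightarrow>
    0 \<in> N \<and> (\<forall>h\<in>N. \<forall>h'\<in>N. h + h' \<in> N) \<and> (\<forall>c. \<forall>h\<in>N. Polynomial.smult c h \<in> N) \<and>
    (\<forall>f g. join f g \<in> N \<longrightarrow> join f 0 \<in> N) \<and> (\<forall>g. \<forall>h\<in>N. omega_gen lam \<alpha> g h \<in> N)"
    (is "_ \<longleftrightarrow> ?R")
proof
  assume N: "sub_supermodule ramond N (omega lam \<alpha>)"
  have act: "act (omega lam \<alpha>) x v \<in> N" if "v \<in> N" for x v
    by (rule sub_supermoduleD(4)[OF N]) (simp_all add: that)
  have sub: "0 \<in> N" "\<forall>h\<in>N. \<forall>h'\<in>N. h + h' \<in> N" "\<forall>c. \<forall>h\<in>N. Polynomial.smult c h \<in> N"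
    using sub_supermoduleD(2)[OF N] unfolding subspace_iff[OF vectorspace_omega] omega_simps by blast+
  have "omega_gen lam \<alpha> g h \<in> N" if "h \<in> N" for g h
    using act[OF that, of "Poly_Mapping.single g 1"] by simp
  moreover have "join f 0 \<in> N" if fg: "join f g \<in> N" for f g
  proof -
    obtain u v where uv: "join f g = u + v" "u \<in> N" "half (Suc 0) u = 0" "half 0 v = 0"
    proof -
      have "join f g \<in> (N \<inter> part (omega lam \<alpha>) 0) <+>\<^bsub>omega lam \<alpha>\<^esub> (N \<inter> part (omega lam \<alpha>) 1)"
        using fg by (simp only: sub_supermoduleD(3)[OF N, symmetric])
      then show ?thesis
        using that by (auto simp: set_add_iff part_omega_iff)
    qed
    have "half 0 u = f"
      using arg_cong[OF uv(1), of "half 0"] uv(4) by (simp add: half_linear)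
    then have "u = join f 0"
      using uv(3) by - (rule half_eqI, simp_all)
    then show ?thesis using uv(2) by simp
  qed
  ultimately show ?R using sub by blast
next
  assume N: ?R
  then have zero: "0 \<in> N" and smult: "\<And>c h. h \<in> N \<Longrightarrow> Polynomial.smult c h \<in> N"
    and add: "\<And>h h'. h \<in> N \<Longrightarrow> h' \<in> N \<Longrightarrow> h + h' \<in> N"
    and even: "\<And>f g. join f g \<in> N \<Longrightarrow> join f 0 \<in> N"
    and gen: "\<And>g h. h \<in> N \<Longrightarrow> omega_gen lam \<alpha> g h \<in> N"
    by blast+
  have "N = (N \<inter> part (omega lam \<alpha>) 0) <+>\<^bsub>omega lam \<alpha>\<^esub> (N \<inter> part (omega lam \<alpha>) 1)"
  proof (intro Set.set_eqI iffI)
    fix h assume h: "h \<in> N"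
    have even: "join (half 0 h) 0 \<in> N"
      by (rule even[of _ "half (Suc 0) h"]) (simp add: h)
    have "h + Polynomial.smult (-1) (join (half 0 h) 0) \<in> N"
      by (intro add smult h even)
    moreover have "h + Polynomial.smult (-1) (join (half 0 h) 0) = join 0 (half (Suc 0) h)"
      by (rule half_eqI) (simp_all add: half_linear)
    moreover have "h = join (half 0 h) 0 + join 0 (half (Suc 0) h)"
      by (simp add: join_add)
    ultimately show "h \<in> (N \<inter> part (omega lam \<alpha>) 0) <+>\<^bsub>omega lam \<alpha>\<^esub> (N \<inter> part (omega lam \<alpha>) 1)"
      using even unfolding set_add_iff omega_simps
      by (intro bexI[of _ "join (half 0 h) 0"] bexI[of _ "join 0 (half (Suc 0) h)"])
        (simp_all add: part_omega_iff)
  qed (auto simp: set_add_iff intro: add)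
  moreover have "act (omega lam \<alpha>) x h \<in> N" if "h \<in> N" for x h
    by (rule poly_mapping_linear_induct[of x UNIV])
      (use that in \<open>auto intro: zero add smult gen\<close>)
  ultimately show "sub_supermodule ramond N (omega lam \<alpha>)"
    unfolding sub_supermodule_def subspace_iff[OF vectorspace_omega] omega_simps
    by (intro conjI supermodule_omega assms) (use zero add smult in auto)
qed

section \<open>Ideals of C[t] invariant under t \<mapsto> t + 1\<close>

lemma shift_invariant_imp_const:
  assumes "shift 1 f = f"
  shows "f = [:poly f 0:]"
proof (rule ccontr)
  assume "f \<noteq> [:poly f 0:]"
  then have "finite {t. poly (f - [:poly f 0:]) t = 0}"
    by (intro poly_roots_finite) simp
  \<comment> \<open>Invariance propagates the value at 0 to all natural numbers, so \<open>f\<close>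
    minus this constant has infinitely many roots.\<close>
  moreover have "poly f (of_nat n) = poly f 0" for n
  proof (induction n)
    case (Suc n)
    then show ?case using poly_shift[of 1 f "of_nat n"] by (simp add: assms add.commute)
  qed simp
  then have "range of_nat \<subseteq> {t. poly (f - [:poly f 0:]) t = 0}"
    by auto
  moreover have "infinite (range (of_nat :: nat \<Rightarrow> complex))"
    by (simp add: range_inj_infinite inj_of_nat)
  ultimately show False using finite_subset by blast
qed

lemma shift_invariant_ideal_eq_UNIV:
  fixes S :: "complex poly set"
  assumes "f \<in> S" "f \<noteq> 0"
    and add: "\<And>p q. p \<in> S \<Longrightarrow> q \<in> S \<Longrightarrow> p + q \<in> S"
    and smult: "\<And>c p. p \<in> S \<Longrightarrow> Polynomial.smult c p \<in> S"
    and var: "\<And>p. p \<in> S \<Longrightarrow> pCons 0 p \<in> S"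
    and shift: "\<And>p. p \<in> S \<Longrightarrow> shift 1 p \<in> S"
  shows "S = UNIV"
proof -
  obtain p where p: "p \<in> S" "p \<noteq> 0" and min: "\<And>q. q \<in> S \<Longrightarrow> q \<noteq> 0 \<Longrightarrow> degree p \<le> degree q"
    using ex_has_least_nat[of "\<lambda>p. p \<in> S \<and> p \<noteq> 0" f degree] assms(1,2) by blast
  \<comment> \<open>The difference operator lowers the degree, so it kills an element of least degree.\<close>
  define q where "q = shift 1 p + Polynomial.smult (-1) p"
  have "q \<in> S"
    unfolding q_def by (intro add smult shift p)
  \<comment> \<open>A translation changes neither degree nor leading coefficient, so the top terms
    cancel in \<open>q\<close>.\<close>
  have "degree (shift 1 p) = degree p" "lead_coeff (shift 1 p) = lead_coeff p"
    unfolding shift_def by (simp add: degree_pcompose, subst lead_coeff_comp) simp_all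
  then have "degree q \<le> degree p" "coeff q (degree p) = 0"
    by (auto simp: q_def intro!: degree_diff_le)
  have "q = 0"
  proof (rule ccontr)
    assume "q \<noteq> 0"
    then have "degree q = degree p"
      using min[OF \<open>q \<in> S\<close>] \<open>degree q \<le> degree p\<close> by simp
    then show False
      using \<open>coeff q (degree p) = 0\<close> \<open>q \<noteq> 0\<close> leading_coeff_0_iff by metis
  qed
  then have "shift 1 p = p" by (simp add: q_def)
  then obtain c where c: "p = [:c:]" using shift_invariant_imp_const by blast
  \<comment> \<open>A nonzero constant \<open>c\<close> lies in \<open>S\<close>. Horner's scheme
    builds every polynomial from it: the factor a / c supplies the next constant term, and
    \<open>var\<close> supplies the multiplication by t.\<close>
  have "r \<in> S" for r
  proof (induction r)
    case 0
    then show ?case using smult[OF p(1), of 0] by simp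
  next
    case (pCons a r)
    have "Polynomial.smult (a / c) p + pCons 0 r \<in> S"
      by (intro add smult var p pCons)
    then show ?case using c p(2) by simp
  qed
  then show ?thesis by blast
qed

text \<open>The rules for the generators have the powers of lam divided out, which is possible as
  lam is nonzero; later comparisons of operators then involve no scalars from lam.\<close>

lemma sub_supermodule_omegaD:
  assumes "lam \<noteq> 0" and N: "sub_supermodule ramond N (omega lam \<alpha>)"
  shows "h \<in> N \<Longrightarrow> h' \<in> N \<Longrightarrow> h + h' \<in> N"
    and "h \<in> N \<Longrightarrow> h' \<in> N \<Longrightarrow> h - h' \<in> N"
    and "h \<in> N \<Longrightarrow> Polynomial.smult c h \<in> N"
    and "join f g \<in> N \<Longrightarrow> join f 0 \<in> N"
    and "join f g \<in> N \<Longrightarrow> join 0 g \<in> N"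
    and "join f g \<in> N \<Longrightarrow> join ([:of_int m * \<alpha>, 1:] * shift (of_int m) f)
      ([:of_int m * \<alpha> + of_int m / 2, 1:] * shift (of_int m) g) \<in> N"
    and "join f g \<in> N \<Longrightarrow>
      join ([:2 * of_int m * \<alpha>, 1:] * shift (of_int m) g) (shift (of_int m) f) \<in> N"
proof -
  note N' = N[unfolded sub_supermodule_omega_iff[OF assms(1)]]
  show add: "h \<in> N \<Longrightarrow> h' \<in> N \<Longrightarrow> h + h' \<in> N"
    and smult: "h \<in> N \<Longrightarrow> Polynomial.smult c h \<in> N"
    and even: "join f g \<in> N \<Longrightarrow> join f 0 \<in> N" for h h' c f g
    using N' by blast+
  show diff: "h \<in> N \<Longrightarrow> h' \<in> N \<Longrightarrow> h - h' \<in> N" for h h'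
    using add[of h "Polynomial.smult (-1) h'"] smult[of h' "-1"] by simp
  show "join f g \<in> N \<Longrightarrow> join 0 g \<in> N"
    using diff[of "join f g" "join f 0"] even by (simp add: join_diff)
  have gen: "h \<in> N" if "omega_gen lam \<alpha> k h' = Polynomial.smult (lam powi m) h" "h' \<in> N" for k m h h'
  proof -
    have "Polynomial.smult (inverse (lam powi m)) (omega_gen lam \<alpha> k h') \<in> N"
      using N' that(2) smult by blast
    then show ?thesis using that(1) assms(1) by simp
  qed
  show "join f g \<in> N \<Longrightarrow> join ([:of_int m * \<alpha>, 1:] * shift (of_int m) f)
      ([:of_int m * \<alpha> + of_int m / 2, 1:] * shift (of_int m) g) \<in> N"
    by (rule gen[OF omega_gen_join(1)])
  show "join f g \<in> N \<Longrightarrow>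
      join ([:2 * of_int m * \<alpha>, 1:] * shift (of_int m) g) (shift (of_int m) f) \<in> N"
    by (rule gen[OF omega_gen_join(2)])
qed

section \<open>Submodules for nonzero \<alpha>\<close>

lemma sub_supermodule_omega_eq_UNIV:
  assumes "lam \<noteq> 0" "\<alpha> \<noteq> 0"
    and N: "sub_supermodule ramond N (omega lam \<alpha>)" and "N \<noteq> {0}"
  shows "N = UNIV"
proof -
  note closed = sub_supermodule_omegaD[OF assms(1) N]
  note L = closed(6) and G = closed(7)
  let ?A = "{f. join f 0 \<in> N}"
  have add: "f + f' \<in> ?A" if "f \<in> ?A" "f' \<in> ?A" for f f'
    using closed(1)[of "join f 0" "join f' 0"] that by (simp add: join_add)
  have smult: "Polynomial.smult c f \<in> ?A" if "f \<in> ?A" for c f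
    using closed(3)[of "join f 0" c] that by (simp add: join_smult)
  have var: "pCons 0 f \<in> ?A" if "f \<in> ?A" for f
    using L[of f 0 0] that by simp
  have shift: "shift 1 f \<in> ?A" if "f \<in> ?A" for f
  proof -
    \<comment> \<open>Without the powers of lam, \<open>G_0 G_1\<close> gives t f(t+1) and
      \<open>L_1\<close> gives (t + \<alpha>) f(t+1). The multiples of t cancel, and division by
      \<alpha> leaves the shift.\<close>
    have "join (pCons 0 (shift 1 f)) 0 \<in> N"
      using G[OF G[of f 0 1], of 0] closed(4) that by simp
    moreover have "join ([:\<alpha>, 1:] * shift 1 f) 0 \<in> N"
      using L[of f 0 1] that by simp
    ultimately have "join ([:\<alpha>, 1:] * shift 1 f) 0 - join (pCons 0 (shift 1 f)) 0 \<in> N"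
      by (intro closed(2))
    from closed(3)[OF this, of "1 / \<alpha>"] show ?thesis
      using assms(2) by (simp add: join_smult join_diff)
  qed
  obtain h where h: "h \<in> N" "h \<noteq> 0"
    using N \<open>N \<noteq> {0}\<close> unfolding sub_supermodule_omega_iff[OF assms(1)] by blast
  have h': "join (half 0 h) (half (Suc 0) h) \<in> N" using h by simp
  \<comment> \<open>If the even half of \<open>h\<close> vanishes, \<open>G_0\<close> moves the odd
    half into \<open>?A\<close>; the factor t that it picks up keeps it nonzero.\<close>
  have "half 0 h \<in> ?A" "pCons 0 (half (Suc 0) h) \<in> ?A"
    using closed(4)[OF h'] closed(4)[OF G[OF h', of 0]] by simp_all
  then obtain f where f: "f \<in> ?A" "f \<noteq> 0"
    using h(2) half_eqI[of h 0] by (metis half_zero pCons_eq_0_iff)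
  have "?A = UNIV"
    by (rule shift_invariant_ideal_eq_UNIV[OF f add smult var shift])
  then have A: "join f 0 \<in> N" for f by blast
  \<comment> \<open>In this direction \<open>G_0\<close> introduces no factor, so the odd part is
    reached completely.\<close>
  have B: "join 0 f \<in> N" for f
    using closed(5)[OF G[OF A[of f], of 0]] by simp
  have "h \<in> N" for h
    using closed(1)[OF A[of "half 0 h"] B[of "half (Suc 0) h"]] by (simp add: join_add)
  then show ?thesis by blast
qed

section \<open>The submodule Xi in the case \<alpha> = 0\<close>

lemma coeff_0_omega_gen [simp]: "coeff (omega_gen lam 0 g h) 0 = 0"
  by (subst coeff_0_half[symmetric], cases g) simp_all

lemma join_var: "join (pCons 0 f) g = var_x ^ 2 * at_sq 0 f + var_x * at_sq 0 g"
  unfolding join_def by (rule poly_eqI_eval) simp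

lemma coeff_0_eq_0_imp_join:
  assumes "coeff h 0 = 0"
  obtains f g where "h = join (pCons 0 f) g"
proof -
  obtain a f where af: "half 0 h = pCons a f" by (rule pCons_cases)
  then have "a = 0" using assms coeff_0_half[of h] by simp
  then have "h = join (pCons 0 f) (half (Suc 0) h)" using join_half[of h] af by simp
  then show ?thesis by (rule that)
qed

text \<open>As the kernel of the functional "constant term", Xi visibly has codimension one; this
  form also makes its closure properties and its cosets immediate.\<close>

lemma Xi_eq: "Xi lam = {h. coeff h 0 = 0}"
proof (rule Set.set_eqI, rule iffI)
  fix h assume "h \<in> Xi lam"
  then obtain f g where "h = var_x ^ 2 * f + g" "half 0 g = 0"
    by (auto simp: Xi_def set_add_iff part_omega_iff)
  then show "h \<in> {h. coeff h 0 = 0}"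
    using coeff_0_half[of g] by (simp add: power2_eq_square)
next
  fix h :: "complex poly" assume "h \<in> {h. coeff h 0 = 0}"
  then obtain f g where h: "h = join (pCons 0 f) g"
    using coeff_0_eq_0_imp_join by blast
  have "at_sq 0 f \<in> part (omega lam 0) 0" "var_x * at_sq 0 g \<in> part (omega lam 0) 1"
    by (simp_all add: omega_def)
  then show "h \<in> Xi lam"
    unfolding h join_var Xi_def set_add_iff omega_simps by blast
qed

text \<open>For \<alpha> = 0 every generator puts a factor t into the even half. Its values thus
  have no constant term, so even the whole module is mapped into Xi.\<close>

lemma sub_supermodule_Xi:
  assumes "lam \<noteq> 0"
  shows "sub_supermodule ramond (Xi lam) (omega lam 0)"
  unfolding sub_supermodule_omega_iff[OF assms] Xi_eq by simp

lemma Xi_proper: "Xi lam \<noteq> {0}" "Xi lam \<noteq> UNIV"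
proof -
  have "var_x \<in> Xi lam" "1 \<notin> Xi lam" by (simp_all add: Xi_eq)
  then show "Xi lam \<noteq> {0}" "Xi lam \<noteq> UNIV"
    by (metis pCons_eq_0_iff singletonD one_neq_zero, metis UNIV_I)
qed

text \<open>On even elements \<open>L_1\<close> and \<open>G_0 G_1\<close> now agree up to lam, so
  the ideal argument is run on the odd component.\<close>

lemma Xi_subset_sub_supermodule:
  assumes "lam \<noteq> 0" and N: "sub_supermodule ramond N (omega lam 0)" and "N \<noteq> {0}"
  shows "Xi lam \<subseteq> N"
proof -
  note closed = sub_supermodule_omegaD[OF assms(1) N]
  note L = closed(6) and G = closed(7)
  let ?B = "{g. join 0 g \<in> N}"
  have add: "g + g' \<in> ?B" if "g \<in> ?B" "g' \<in> ?B" for g g'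
    using closed(1)[of "join 0 g" "join 0 g'"] that by (simp add: join_add)
  have smult: "Polynomial.smult c g \<in> ?B" if "g \<in> ?B" for c g
    using closed(3)[of "join 0 g" c] that by (simp add: join_smult)
  have var: "pCons 0 g \<in> ?B" if "g \<in> ?B" for g
    using L[of 0 g 0] that by simp
  have shift: "shift 1 g \<in> ?B" if "g \<in> ?B" for g
  proof -
    \<comment> \<open>The two operators give t g(t+1) and (t + 1/2) g(t+1); doubling their
      difference leaves the shift.\<close>
    have "join 0 (pCons 0 (shift 1 g)) \<in> N"
      using G[OF G[of 0 g 1], of 0] that by simp
    moreover have "join 0 ([:1 / 2, 1:] * shift 1 g) \<in> N"
      using L[of 0 g 1] that by simp
    ultimately have "join 0 ([:1 / 2, 1:] * shift 1 g) - join 0 (pCons 0 (shift 1 g)) \<in> N"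
      by (intro closed(2))
    from closed(3)[OF this, of 2] show ?thesis
      by (simp add: join_smult join_diff)
  qed
  obtain h where h: "h \<in> N" "h \<noteq> 0"
    using N \<open>N \<noteq> {0}\<close> unfolding sub_supermodule_omega_iff[OF assms(1)] by blast
  have h': "join (half 0 h) (half (Suc 0) h) \<in> N" using h by simp
  have "half 0 h \<in> ?B" "half (Suc 0) h \<in> ?B"
    using G[OF closed(4)[OF h'], of 0] closed(5)[OF h'] by simp_all
  then obtain g where g: "g \<in> ?B" "g \<noteq> 0"
    using h(2) half_eqI[of h 0] by (metis half_zero)
  have "?B = UNIV"
    by (rule shift_invariant_ideal_eq_UNIV[OF g add smult var shift])
  then have B: "join 0 g \<in> N" for g by blast
  \<comment> \<open>From the odd side \<open>G_0\<close> reaches exactly the even elements divisible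
    by x^2.\<close>
  have A: "join (pCons 0 f) 0 \<in> N" for f
    using G[OF B[of f], of 0] by simp
  have "join (pCons 0 f) g \<in> N" for f g
    using closed(1)[OF A[of f] B[of g]] by (simp add: join_add)
  then show ?thesis
    unfolding Xi_eq by (auto elim!: coeff_0_eq_0_imp_join)
qed

lemma sub_supermodule_omega_0_eq_Xi:
  assumes "lam \<noteq> 0" and N: "sub_supermodule ramond N (omega lam 0)" and "N \<noteq> {0}" "N \<noteq> UNIV"
  shows "N = Xi lam"
proof
  show Xi: "Xi lam \<subseteq> N" by (rule Xi_subset_sub_supermodule) fact+
  note closed = sub_supermodule_omegaD[OF assms(1) N]
  show "N \<subseteq> Xi lam"
  proof (rule ccontr)
    assume "\<not> N \<subseteq> Xi lam"
    then obtain h where h: "h \<in> N" "coeff h 0 \<noteq> 0" by (auto simp: Xi_eq)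
    have "k \<in> N" for k
    proof -
      \<comment> \<open>This multiple of \<open>h\<close> cancels the constant term of
        \<open>k\<close> and leaves an element of Xi.\<close>
      let ?c = "coeff k 0 / coeff h 0"
      have "k - Polynomial.smult ?c h \<in> N" using Xi h by (auto simp: Xi_eq)
      then have "(k - Polynomial.smult ?c h) + Polynomial.smult ?c h \<in> N"
        using closed h(1) by blast
      then show ?thesis by simp
    qed
    then show False using \<open>N \<noteq> UNIV\<close> by blast
  qed
qed

section \<open>Restriction, change of parity and the quotient\<close>

lemma vectorspace_part_update [simp]:
  "vectorspace complex_field (V\<lparr>part := p\<rparr>) \<longleftrightarrow> vectorspace complex_field V"
  by (simp add: vectorspace_def Module.module_def module_axioms_def abelian_group_def
      abelian_monoid_def abelian_group_axioms_def)

lemma subspace_part_update [simp]: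
  "VectorSpace.subspace complex_field N (V\<lparr>part := p\<rparr>) \<longleftrightarrow> VectorSpace.subspace complex_field N V"
proof (cases "vectorspace complex_field V")
  case True
  then have "vectorspace complex_field (V\<lparr>part := p\<rparr>)" by simp
  from subspace_iff[OF this] subspace_iff[OF True] show ?thesis by simp
qed (simp add: VectorSpace.subspace_def)

text \<open>The operations are inherited, and so are their laws. That the restricted parts still add
  up to \<open>N\<close> is precisely the gradedness required of a submodule.\<close>

lemma supermodule_restrict:
  assumes N: "sub_supermodule A N M"
  shows "supermodule A (restrict_supermodule M N)"
proof -
  interpret M: supermodule A M by (rule sub_supermoduleD(1)[OF N])
  let ?R = "restrict_supermodule M N"
  have R [simp]: "carrier ?R = N" "add ?R = add M" "zero ?R = zero M" "smult ?R = smult M"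
    "act ?R = act M" "part ?R i = N \<inter> part M i" for i
    by (simp_all add: restrict_supermodule_def)
  have subspace: "VectorSpace.subspace complex_field N M"
    by (rule sub_supermoduleD(2)[OF N])
  have act: "act M x v \<in> N" if "x \<in> carrier A" "v \<in> N" for x v
    using sub_supermoduleD(4)[OF N] that .
  have part_A: "part A i \<subseteq> carrier A" for i
    using M.A.part_subspace[of i] unfolding subspace_iff[OF M.A.vectorspace_axioms] by blast
  have vs_M: "vectorspace complex_field M" by (rule M.vectorspace_axioms)
  note sub = subspace[unfolded subspace_iff[OF vs_M]]
  have in_M: "v \<in> carrier M" if "v \<in> N" for v
    using that sub by blast
  have vs: "vectorspace complex_field ?R"
    using vectorspace.subspace_is_vs[OF vs_M subspace] by (simp add: restrict_supermodule_def)
  have minus: "v \<ominus>\<^bsub>?R\<^esub> w = v \<ominus>\<^bsub>M\<^esub> w" if "v \<in> N" "w \<in> N" for v w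
    using that in_M minus_eq_smult[OF vs, of v w] minus_eq_smult[OF vs_M, of v w]
    by simp
  have "superspace ?R"
  proof (intro superspace.intro superspace_axioms.intro vs)
    show "VectorSpace.subspace complex_field (part ?R i) ?R" for i
      using M.part_subspace[of i] sub unfolding subspace_iff[OF vs] subspace_iff[OF vs_M] by auto
    show "part ?R 0 <+>\<^bsub>?R\<^esub> part ?R 1 = carrier ?R"
      using sub_supermoduleD(3)[OF N] by (simp only: R set_add_cong[of ?R M, OF R(2)])
    show "part ?R 0 \<inter> part ?R 1 = {\<zero>\<^bsub>?R\<^esub>}"
      using M.part_disjoint sub by auto
  qed
  moreover have "bilinear_on A ?R ?R (act ?R)"
    using M.act_bilinear act in_M by (simp add: bilinear_on_def module_hom_iff)
  moreover have "act ?R x v \<in> part ?R (i + j)" if "x \<in> part A i" "v \<in> part ?R j" for x v i j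
    using that M.act_part[of x i v j] act[of x v] subsetD[OF part_A that(1)]
    by (simp del: add_bit_eq_xor)
  moreover have "act ?R (bracket A x y) v =
      act ?R x (act ?R y v) \<ominus>\<^bsub>?R\<^esub> koszul i j \<odot>\<^bsub>?R\<^esub> act ?R y (act ?R x v)"
    if "x \<in> part A i" "y \<in> part A j" "v \<in> carrier ?R" for x y v i j
  proof -
    have "x \<in> carrier A" "y \<in> carrier A" "v \<in> N" "v \<in> carrier M"
      using that part_A sub by auto
    then show ?thesis
      using M.act_bracket[OF that(1,2)] sub by (simp add: minus act)
  qed
  ultimately show ?thesis
    by (intro supermodule.intro supermodule_axioms.intro M.A.lie_superalgebra_axioms)
qed

lemma supermodule_parity_change:
  assumes "supermodule A M"
  shows "supermodule A (parity_change M)"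
proof -
  interpret M: supermodule A M by fact
  let ?P = "parity_change M"
  have P [simp]: "carrier ?P = carrier M" "add ?P = add M" "zero ?P = zero M" "smult ?P = smult M"
    "act ?P = act M" "part ?P i = part M (i + 1)" for i
    by (simp_all add: parity_change_def)
  have vs_M: "vectorspace complex_field M" by (rule M.vectorspace_axioms)
  then have vs: "vectorspace complex_field ?P" by (simp add: parity_change_def)
  have minus: "v \<ominus>\<^bsub>?P\<^esub> w = v \<ominus>\<^bsub>M\<^esub> w" if "v \<in> carrier M" "w \<in> carrier M" for v w
    using that minus_eq_smult[OF vs, of v w] minus_eq_smult[OF vs_M, of v w] by simp
  have part_M: "part M i \<subseteq> carrier M" for i
    using M.part_subspace[of i] unfolding subspace_iff[OF vs_M] by blast
  have part_A: "part A i \<subseteq> carrier A" for i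
    using M.A.part_subspace[of i] unfolding subspace_iff[OF M.A.vectorspace_axioms] by blast
  have act_closed: "act M x v \<in> carrier M" if "x \<in> carrier A" "v \<in> carrier M" for x v
    using M.act_bilinear that by (auto simp: bilinear_on_def module_hom_iff)
  have smult_closed: "c \<odot>\<^bsub>M\<^esub> v \<in> carrier M" if "v \<in> carrier M" for c v
    using M.smult_closed that by simp
  have "part M 1 <+>\<^bsub>M\<^esub> part M 0 = part M 0 <+>\<^bsub>M\<^esub> part M 1"
  proof -
    have "v \<oplus>\<^bsub>M\<^esub> w = w \<oplus>\<^bsub>M\<^esub> v" if "v \<in> part M i" "w \<in> part M j" for v w i j
      using M.a_comm that part_M by blast
    then show ?thesis by (auto simp: set_add_iff Set.set_eq_iff; metis)
  qed
  then have "superspace ?P"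
    using M.part_subspace M.part_sum M.part_disjoint vs
    by (intro superspace.intro superspace_axioms.intro vs)
      (auto simp: subspace_iff[OF vs] subspace_iff[OF vs_M] set_add_cong[of ?P M, OF P(2)])
  moreover have "bilinear_on A ?P ?P (act ?P)"
    using M.act_bilinear by (simp add: bilinear_on_def module_hom_iff)
  \<comment> \<open>Shifting only the parity of the module respects the rule, since i + (j + 1) = (i
    + j) + 1.\<close>
  moreover have "act ?P x v \<in> part ?P (i + j)" if "x \<in> part A i" "v \<in> part ?P j" for x v i j
    using that M.act_part[of x i v "j + 1"] by (simp add: add.assoc del: add_bit_eq_xor)
  moreover have "act ?P (bracket A x y) v =
      act ?P x (act ?P y v) \<ominus>\<^bsub>?P\<^esub> koszul i j \<odot>\<^bsub>?P\<^esub> act ?P y (act ?P x v)"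
    if "x \<in> part A i" "y \<in> part A j" "v \<in> carrier ?P" for x y v i j
  proof -
    have "x \<in> carrier A" "y \<in> carrier A" using that part_A by auto
    then show ?thesis
      using M.act_bracket[OF that(1,2)] that(3) by (simp add: minus act_closed smult_closed)
  qed
  ultimately show ?thesis
    by (intro supermodule.intro supermodule_axioms.intro M.A.lie_superalgebra_axioms)
qed

lemma sub_supermodule_of_restrict:
  assumes "sub_supermodule A N M" and N': "sub_supermodule A N' (restrict_supermodule M N)"
  shows "sub_supermodule A N' M"
proof -
  let ?R = "restrict_supermodule M N"
  have R [simp]: "carrier ?R = N" "add ?R = add M" "zero ?R = zero M" "smult ?R = smult M"
    "act ?R = act M" "part ?R i = N \<inter> part M i" for i
    by (simp_all add: restrict_supermodule_def)
  have M: "supermodule A M" by (rule sub_supermoduleD(1)) fact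
  interpret M: supermodule A M by fact
  interpret R: supermodule A ?R by (rule supermodule_restrict) fact
  have sub: "N \<subseteq> carrier M"
    using sub_supermoduleD(2)[OF assms(1)] unfolding subspace_iff[OF M.vectorspace_axioms] by blast
  note sub' = sub_supermoduleD(2)[OF N', unfolded subspace_iff[OF R.vectorspace_axioms] R]
  then have "N' \<inter> (N \<inter> part M i) = N' \<inter> part M i" for i by blast
  then have "N' = (N' \<inter> part M 0) <+>\<^bsub>M\<^esub> (N' \<inter> part M 1)"
    using sub_supermoduleD(3)[OF N'] by (simp only: R set_add_cong[of ?R M, OF R(2)])
  moreover have "VectorSpace.subspace complex_field N' M"
    using sub' sub unfolding subspace_iff[OF M.vectorspace_axioms] by blast
  ultimately show ?thesis
    unfolding sub_supermodule_def using M sub_supermoduleD(4)[OF N'] by (simp only: R) blast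
qed

text \<open>Simplicity is drawn from the classification for \<alpha> = 0, not transported along the
  isomorphism: a submodule of Xi is a submodule of the whole module, and it is proper because Xi
  is.\<close>

lemma simple_restrict_Xi:
  assumes "lam \<noteq> 0"
  shows "simple_supermodule ramond (restrict_supermodule (omega lam 0) (Xi lam))"
  unfolding simple_supermodule_def
proof (intro conjI allI impI)
  let ?R = "restrict_supermodule (omega lam 0) (Xi lam)"
  show "supermodule ramond ?R"
    by (rule supermodule_restrict[OF sub_supermodule_Xi[OF assms]])
  show "carrier ?R \<noteq> {\<zero>\<^bsub>?R\<^esub>}"
    using Xi_proper(1) by (simp add: restrict_supermodule_def)
  fix N assume N: "sub_supermodule ramond N ?R"
  then have N_sub: "N \<subseteq> Xi lam"
    unfolding sub_supermodule_def VectorSpace.subspace_def submodule_def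
    by (simp add: restrict_supermodule_def)
  have "sub_supermodule ramond N (omega lam 0)"
    by (rule sub_supermodule_of_restrict[OF sub_supermodule_Xi[OF assms] N])
  then have "N = {0} \<or> N = Xi lam"
    using sub_supermodule_omega_0_eq_Xi[OF assms, of N] Xi_proper(2) N_sub by blast
  then show "N = {\<zero>\<^bsub>?R\<^esub>} \<or> N = carrier ?R"
    by (simp add: restrict_supermodule_def)
qed

section \<open>Multiplication by x and the isomorphism\<close>

lemma half_pCons_0 [simp]:
  "half 0 (pCons 0 h) = pCons 0 (half (Suc 0) h)" "half (Suc 0) (pCons 0 h) = half 0 h"
  by (rule poly_eqI, simp add: coeff_half coeff_pCons split: nat.split)+

text \<open>Multiplication by x, which is \<open>pCons 0\<close>, sends the halves (f, g) to (t g,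
  f). The factor t + m/2 of \<open>L_m\<close> on f, now an odd half, is t + m \<alpha> for \<alpha>
  = 1/2. On t g the shift gives t (t + m) g(t+m), and t + m is t + m \<alpha> + m/2 for the same
  \<alpha>.\<close>

lemma omega_gen_pCons_0: "omega_gen lam 0 g (pCons 0 h) = pCons 0 (omega_gen lam (1/2) g h)"
  by (cases g; rule half_eqI; rule poly_eqI_eval; simp add: field_simps)

lemma act_omega_pCons_0:
  "act (omega lam 0) x (pCons 0 h) = pCons 0 (act (omega lam (1/2)) x h)"
  by (rule poly_mapping_linear_induct[of x UNIV]) (simp_all add: omega_gen_pCons_0)

lemma Xi_isomorphic:
  assumes "lam \<noteq> 0"
  shows "supermodule_isomorphic ramond (restrict_supermodule (omega lam 0) (Xi lam))
    (parity_change (omega lam (1/2)))"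
  unfolding supermodule_isomorphic_def
\<comment> \<open>Dropping the constant coefficient is division by x on Xi, with inverse
  \<open>pCons 0\<close>. It reverses parities, which \<open>parity_change\<close>
  compensates.\<close>
proof (intro conjI exI[of _ "poly_shift 1"])
  let ?R = "restrict_supermodule (omega lam 0) (Xi lam)" and ?P = "parity_change (omega lam (1/2))"
  show "supermodule ramond ?R"
    by (rule supermodule_restrict[OF sub_supermodule_Xi[OF assms]])
  show "supermodule ramond ?P"
    by (rule supermodule_parity_change[OF supermodule_omega[OF assms]])
  have shift [simp]: "poly_shift (Suc 0) (pCons 0 h) = h" for h :: "complex poly"
    by (rule poly_eqI) (simp add: coeff_poly_shift)
  have Xi: "Xi lam = range (pCons 0)"
  proof (intro Set.set_eqI iffI)
    fix h assume "h \<in> Xi lam"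
    then show "h \<in> range (pCons 0)" by (cases h) (auto simp: Xi_eq)
  qed (auto simp: Xi_eq)
  have R [simp]: "carrier ?R = Xi lam" "add ?R = (+)" "smult ?R = Polynomial.smult"
      "act ?R = act (omega lam 0)" "part ?R i = Xi lam \<inter> part (omega lam 0) i"
    and P [simp]: "carrier ?P = UNIV" "add ?P = (+)" "smult ?P = Polynomial.smult"
      "act ?P = act (omega lam (1/2))" "part ?P i = part (omega lam (1/2)) (i + 1)" for i
    by (simp_all add: restrict_supermodule_def parity_change_def)
  have plus: "pCons 0 v + pCons 0 w = pCons 0 (v + w)" "Polynomial.smult c (pCons 0 v) = pCons 0 (Polynomial.smult c v)"
    for v w :: "complex poly" and c by simp_all
  show "poly_shift 1 \<in> LinearCombinations.module_hom complex_field ?R ?P"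
    unfolding module_hom_iff R P unfolding Xi by (auto simp: plus simp del: add_pCons smult_pCons)
  show "bij_betw (poly_shift 1) (carrier ?R) (carrier ?P)"
    unfolding R P by (rule bij_betwI[where g = "pCons 0"]) (auto simp: Xi)
  show "\<forall>i. poly_shift 1 ` part ?R i \<subseteq> part ?P i"
  proof
    fix i :: bit
    show "poly_shift 1 ` part ?R i \<subseteq> part ?P i"
      unfolding R P by (cases i) (auto simp: Xi part_omega_iff)
  qed
  show "\<forall>x\<in>carrier ramond. \<forall>v\<in>carrier ?R. poly_shift 1 (act ?R x v) = act ?P x (poly_shift 1 v)"
    unfolding R P by (auto simp: Xi act_omega_pCons_0)
qed

section \<open>The quotient by Xi, identified with C by the constant term\<close>

definition const_coset :: "complex \<Rightarrow> complex poly set"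
  where "const_coset c = {h. coeff h 0 = c}"

lemma const_coset_eq_iff [simp]: "const_coset a = const_coset b \<longleftrightarrow> a = b"
proof
  assume "const_coset a = const_coset b"
  moreover have "[:a:] \<in> const_coset a" by (simp add: const_coset_def)
  ultimately show "a = b" by (auto simp: const_coset_def)
qed simp

lemma Xi_coset: "Xi lam +>\<^bsub>omega lam \<alpha>\<^esub> h = const_coset (coeff h 0)"
proof (intro Set.set_eqI iffI)
  fix k assume "k \<in> const_coset (coeff h 0)"
  then have "k - h \<in> Xi lam" "k = (k - h) + h" by (simp_all add: const_coset_def Xi_eq)
  then show "k \<in> Xi lam +>\<^bsub>omega lam \<alpha>\<^esub> h" unfolding a_r_coset_def' omega_simps by blast
qed (auto simp: a_r_coset_def' const_coset_def Xi_eq)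

text \<open>The operations on cosets are unions over representatives. Each union collapses because
  the constant term of the result does not depend on the representative.\<close>

lemma quotient_Xi_simps:
  fixes lam
  defines "Q \<equiv> quotient_supermodule (omega lam 0) (Xi lam)"
  shows "carrier Q = range const_coset"
    and "const_coset a \<oplus>\<^bsub>Q\<^esub> const_coset b = const_coset (a + b)"
    and "\<zero>\<^bsub>Q\<^esub> = const_coset 0"
    and "c \<odot>\<^bsub>Q\<^esub> const_coset a = const_coset (c * a)"
    and "part Q 0 = range const_coset" "part Q 1 = {const_coset 0}"
    and "act Q x (const_coset a) = const_coset 0"
proof -
  have const: "h \<in> const_coset a \<longleftrightarrow> coeff h 0 = a" "[:a:] \<in> const_coset a" for h a
    by (simp_all add: const_coset_def)
  \<comment> \<open>A union of equal sets over a coset is that set only if the coset has an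
    element.\<close>
  then have nonempty: "const_coset a \<noteq> {}" for a by blast
  show "carrier Q = range const_coset"
    unfolding Q_def quotient_supermodule_def A_RCOSETS_def' partial_object.simps Xi_coset omega_simps
    by (auto simp: image_iff) (metis coeff_pCons_0)
  show "const_coset a \<oplus>\<^bsub>Q\<^esub> const_coset b = const_coset (a + b)"
  proof (intro Set.set_eqI iffI)
    fix h assume "h \<in> const_coset (a + b)"
    then have "h = (h - [:b:]) + [:b:]" "h - [:b:] \<in> const_coset a" by (simp_all add: const)
    then show "h \<in> const_coset a \<oplus>\<^bsub>Q\<^esub> const_coset b"
      using const(2)[of b] unfolding Q_def quotient_supermodule_def
      by (simp add: set_add_iff) (metis diff_add_cancel)
  qed (auto simp: Q_def quotient_supermodule_def set_add_iff const)
  show "\<zero>\<^bsub>Q\<^esub> = const_coset 0"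
    by (simp add: Q_def quotient_supermodule_def Xi_eq const_coset_def)
  show "c \<odot>\<^bsub>Q\<^esub> const_coset a = const_coset (c * a)"
    using nonempty by (auto simp: Q_def quotient_supermodule_def Xi_coset const)
  have act: "coeff (act (omega lam 0) x h) 0 = 0" for x h
    by (rule poly_mapping_linear_induct[of x UNIV]) simp_all
  show "act Q x (const_coset a) = const_coset 0"
    using nonempty by (auto simp: Q_def quotient_supermodule_def Xi_coset act)
  show "part Q 0 = range const_coset"
  proof -
    have "[:a:] \<in> part (omega lam 0) 0" for a
      unfolding part_omega_iff by (rule poly_eqI) (simp add: coeff_half)
    then have "const_coset a \<in> part Q 0" for a
      unfolding Q_def quotient_supermodule_def by (auto simp: Xi_coset intro!: exI[of _ "[:a:]"])
    then show ?thesis by (auto simp: Q_def quotient_supermodule_def Xi_coset)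
  qed
  \<comment> \<open>Odd polynomials have no constant term, so the one-dimensional quotient is purely
    even.\<close>
  have "coeff h 0 = 0" if "h \<in> part (omega lam 0) 1" for h
    using that coeff_0_half[of h] by (simp add: part_omega_iff)
  then show "part Q 1 = {const_coset 0}"
    by (auto simp: Q_def quotient_supermodule_def Xi_coset intro!: exI[of _ 0] part_omega_0)
qed

lemma quotient_Xi:
  fixes lam
  defines "Q \<equiv> quotient_supermodule (omega lam 0) (Xi lam)"
  shows "trivial_supermodule ramond Q" "vectorspace.fin_dim complex_field Q"
    "vectorspace.dim complex_field Q = 1"
proof -
  note Q = quotient_Xi_simps[of lam, folded Q_def]
  have "abelian_group Q"
  proof (rule abelian_groupI)
    fix v assume "v \<in> carrier Q"
    then obtain a where "v = const_coset a" by (auto simp: Q)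
    then show "\<exists>w\<in>carrier Q. w \<oplus>\<^bsub>Q\<^esub> v = \<zero>\<^bsub>Q\<^esub>"
      by (intro bexI[of _ "const_coset (- a)"]) (simp_all add: Q)
  qed (auto simp: Q algebra_simps)
  moreover have "module_axioms complex_field Q"
    by unfold_locales (auto simp: Q algebra_simps)
  ultimately have vs: "vectorspace complex_field Q"
    by (simp add: vectorspace_def Module.module_def class_field class_cring.is_cring)
  interpret vectorspace complex_field Q by fact
  have "superspace Q"
  proof (intro superspace.intro superspace_axioms.intro vs)
    show "VectorSpace.subspace complex_field (part Q i) Q" for i
      unfolding subspace_iff[OF vs] by (cases i) (auto simp: Q)
    show "part Q 0 <+>\<^bsub>Q\<^esub> part Q 1 = carrier Q"
      by (auto simp: Q set_add_iff)
    show "part Q 0 \<inter> part Q 1 = {\<zero>\<^bsub>Q\<^esub>}" by (auto simp: Q)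
  qed
  moreover have "bilinear_on ramond Q Q (act Q)"
    by (auto simp: bilinear_on_def module_hom_iff Q)
  \<comment> \<open>The value is the zero coset, which lies in both parts, so any target parity is
    correct.\<close>
  moreover have "act Q x v \<in> part Q i" if "v \<in> carrier Q" for x v i
    using that by (cases i) (auto simp: Q)
  moreover have "part Q i \<subseteq> carrier Q" for i
    by (cases i) (auto simp: Q)
  moreover have "act Q (bracket ramond x y) v = act Q x (act Q y v) \<ominus>\<^bsub>Q\<^esub> c \<odot>\<^bsub>Q\<^esub> act Q y (act Q x v)"
    if "v \<in> carrier Q" for x y v c
    using that by (auto simp: Q minus_eq_smult[OF vs])
  ultimately have "supermodule ramond Q"
    by (intro supermodule.intro supermodule_axioms.intro lie_superalgebra_ramond) blast+
  then show "trivial_supermodule ramond Q"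
    by (auto simp: trivial_supermodule_def Q)
  have one: "const_coset 1 \<in> carrier Q" by (simp add: Q)
  have "v \<in> span {const_coset 1}" if "v \<in> carrier Q" for v
  proof -
    obtain a where "v = const_coset a" using \<open>v \<in> carrier Q\<close> by (auto simp: Q)
    then have "v = a \<odot>\<^bsub>Q\<^esub> const_coset 1" by (simp add: Q)
    moreover have "submodule complex_field (span {const_coset 1}) Q"
      by (rule span_is_submodule) (simp add: one)
    moreover have "const_coset 1 \<in> span {const_coset 1}"
      using in_own_span[of "{const_coset 1}"] one by auto
    ultimately show ?thesis by (simp add: submodule.smult_closed)
  qed
  then have gen: "gen_set {const_coset 1}"
    using span_is_subset2[of "{const_coset 1}"] one by auto
  then show "fin_dim" unfolding fin_dim_def using one by blast
  show "dim = 1" by (rule dim1I[OF gen _ one]) (simp add: Q)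
qed

theorem theorem2p6:
  fixes lam \<alpha> :: complex
  assumes "lam \<noteq> 0"
  shows "(simple_supermodule ramond (omega lam \<alpha>) \<longleftrightarrow> \<alpha> \<noteq> 0)
    \<and> {N. sub_supermodule ramond N (omega lam 0) \<and>
          N \<noteq> {\<zero>\<^bsub>omega lam 0\<^esub>} \<and> N \<noteq> carrier (omega lam 0)} = {Xi lam}
    \<and> (let Q = quotient_supermodule (omega lam 0) (Xi lam) in
         trivial_supermodule ramond Q \<and>
         vectorspace.fin_dim complex_field Q \<and> vectorspace.dim complex_field Q = 1)
    \<and> supermodule_isomorphic ramond (restrict_supermodule (omega lam 0) (Xi lam))
         (parity_change (omega lam (1/2)))
    \<and> simple_supermodule ramond (restrict_supermodule (omega lam 0) (Xi lam))"
proof (intro conjI)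
  show "simple_supermodule ramond (omega lam \<alpha>) \<longleftrightarrow> \<alpha> \<noteq> 0"
  proof
    assume simple: "simple_supermodule ramond (omega lam \<alpha>)"
    show "\<alpha> \<noteq> 0"
    proof
      assume "\<alpha> = 0"
      then show False
        using simple sub_supermodule_Xi[OF assms] Xi_proper[of lam]
        unfolding simple_supermodule_def omega_simps by blast
    qed
  next
    assume "\<alpha> \<noteq> 0"
    moreover have "UNIV \<noteq> {0 :: complex poly}" using one_neq_zero by blast
    ultimately show "simple_supermodule ramond (omega lam \<alpha>)"
      using supermodule_omega[OF assms] sub_supermodule_omega_eq_UNIV[OF assms]
      by (auto simp: simple_supermodule_def)
  qed
  show "{N. sub_supermodule ramond N (omega lam 0) \<and>
      N \<noteq> {\<zero>\<^bsub>omega lam 0\<^esub>} \<and> N \<noteq> carrier (omega lam 0)} = {Xi lam}"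
    unfolding omega_simps
    using sub_supermodule_omega_0_eq_Xi[OF assms] sub_supermodule_Xi[OF assms] Xi_proper[of lam]
    by blast
qed (simp_all only: Let_def quotient_Xi Xi_isomorphic[OF assms] simple_restrict_Xi[OF assms] simp_thms)

end
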